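(* Let $n\ge3$, $h>0$, and let $\bm Z=((X_1,f(X_1)),\dots,(X_n,f(X_n)))$ represent $n$ samples of a function $f\colon\mathbb T\to\mathbb R$ with Lipschitz constant $L>0$, where $X_1,\dots,X_n$ are independent and uniformly distributed on $\mathbb T$. Let $R_h$ denote reconstruction via Shepard's model (defined in the context), where the kernel function $k_h$ is supported on $[0,1/h]$. Let $$\gamma=\sum_{k=1}^{\lfloor h\rfloor}(-1)^{k+1}\binom nk\left(1-\frac k{2h}\right)^{n-1} \quad\text{and}\quad \varepsilon>2\gamma\max\{(4n+1)L^2/h^2,\ 4\|f\|_\infty^2\}.$$ Then $$\mathbb P\left\{\left|\mathrm{CV}(\bm Z,h)-\mathcal E(R_h(\bm Z_{-1}))\right|>\varepsilon\right\}\le2\gamma+2\exp\left(-\left(\frac{h^2\varepsilon}{12\sqrt n\,L^2}-\sqrt{2n}\,\gamma\right)^2\right).$$ In particular, for $0<\delta\le1$, with probability larger than $1-2(\gamma+\delta)$, $$|\mathrm{CV}(\bm Z,h)-\mathcal E(R_h(\bm Z_{-1}))|\le\max\left\{4\gamma\|f\|_\infty^2,\ \frac{12\sqrt n\,L^2}{h^2}\left(\sqrt{2n}\,\gamma+\sqrt{-\log\delta}\right)\right\}.$$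
   Context: $\mathbb T=\mathbb R/\mathbb Z$ is the one-dimensional torus (length $1$) with the usual periodic distance $d(\cdot,\cdot)$ and uniform probability measure $\rho$; Lipschitz continuity is with respect to $d$, and $\|f\|_\infty=\sup_{x\in\mathbb T}|f(x)|$. Kernel: $K_h(x,x')=k_h(d(x,x'))$ with $k_h\colon[0,\infty)\to[0,\infty)$ positive and locally supported: $\operatorname{supp}k_h=\overline{\{t\in[0,\infty):k_h(t)\ne0\}}=[0,1/h]$, and $k_h(t)>0$ for $0\le t<1/h$. Shepard's model: for a list of samples $\bm z=(x_i,f(x_i))_{i=1}^N$, $$R_h(\bm z)=\frac{\sum_{i=1}^NK_h(\cdot,x_i)f(x_i)}{\sum_{i=1}^NK_h(\cdot,x_i)},$$ with value $0$ at points where the denominator vanishes. For $\bm z=(z_1,\dots,z_n)$, $\bm z_{-i}=(z_1,\dots,z_{i-1},z_{i+1},\dots,z_n)$. Risk functional: $\mathcal E(g)=\int_{\mathbb T}|g(x)-f(x)|^2\,\mathrm d\rho(x)$. Leave-one-out cross-validation score: $\mathrm{CV}(\bm z,h)=\frac1n\sum_{i=1}^n|R_h(\bm z_{-i})(x_i)-f(x_i)|^2$ for $\bm z=(x_i,f(x_i))_{i=1}^n$. *)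

theory Defs
  imports "HOL-Probability.Probability"
begin

quotient_type torus = real / "\<lambda>x y :: real. x - y \<in> \<int>"
  morphisms torus_rep torus_of_real
proof (rule equivpI)
  show "reflp (\<lambda>x y :: real. x - y \<in> \<int>)"
    by (auto simp: reflp_def)
  show "symp (\<lambda>x y :: real. x - y \<in> \<int>)"
    by (metis (mono_tags, lifting) Ints_minus minus_diff_eq sympI)
  show "transp (\<lambda>x y :: real. x - y \<in> \<int>)"
    by (metis (mono_tags, lifting) Ints_add diff_add_cancel add_diff_eq transpI)
qed

lemma closed_Ints_real: "closed (\<int> :: real set)"
  by (auto simp: Ints_def intro: closed_of_int_image)

lemma infdist_Ints_shift_le:
  fixes a b :: real
  assumes "a - b \<in> \<int>"
  shows "infdist a \<int> \<le> infdist b \<int>"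
proof -
  obtain m where m: "m \<in> \<int>" "infdist b \<int> = dist b m"
    using infdist_attains_inf[OF closed_Ints_real, of b] by (metis Ints_0 empty_iff)
  have "infdist a \<int> \<le> dist a (m + (a - b))"
    using m assms by (intro infdist_le) auto
  then show ?thesis
    using m by (simp add: dist_real_def)
qed

lemma infdist_Ints_shift:
  fixes a b :: real
  assumes "a - b \<in> \<int>"
  shows "infdist a \<int> = infdist b \<int>"
  using assms infdist_Ints_shift_le[of a b] infdist_Ints_shift_le[of b a]
  by (metis Ints_minus minus_diff_eq order_antisym)

instantiation torus :: metric_space
begin

text \<open>The periodic distance of two classes is the distance of a difference of
  representatives from the set of integers.\<close>

lift_definition dist_torus :: "torus \<Rightarrow> torus \<Rightarrow> real" is
  "\<lambda>x y. infdist (x - y) \<int>"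
proof (rule infdist_Ints_shift)
  fix a b c d :: real
  assume "a - b \<in> \<int>" "c - d \<in> \<int>"
  then have "(a - b) - (c - d) \<in> \<int>" by (rule Ints_diff)
  then show "(a - c) - (b - d) \<in> \<int>" by (simp add: algebra_simps)
qed

definition uniformity_torus :: "(torus \<times> torus) filter" where
  "uniformity_torus = (INF e\<in>{0 <..}. principal {(x, y). dist x y < e})"

definition open_torus :: "torus set \<Rightarrow> bool" where
  "open_torus U = (\<forall>x\<in>U. eventually (\<lambda>(x', y). x' = x \<longrightarrow> y \<in> U) uniformity)"

instance
proof
  show "uniformity = (INF e\<in>{0 <..}. principal {(x, y :: torus). dist x y < e})"
    by (rule uniformity_torus_def)
  show "open U = (\<forall>x\<in>U. \<forall>\<^sub>F (x', y) in uniformity. x' = x \<longrightarrow> y \<in> U)" for U :: "torus set"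
    by (rule open_torus_def)
  show "dist x y = 0 \<longleftrightarrow> x = y" for x y :: torus
  proof transfer
    fix x y :: real
    show "infdist (x - y) \<int> = 0 \<longleftrightarrow> x - y \<in> \<int>"
      using in_closed_iff_infdist_zero[OF closed_Ints_real] by (metis Ints_0 empty_iff)
  qed
  show "dist x y \<le> dist x z + dist y z" for x y z :: torus
  proof transfer
    fix x y z :: real
    obtain m where m: "m \<in> \<int>" "infdist (x - z) \<int> = dist (x - z) m"
      using infdist_attains_inf[OF closed_Ints_real] by (metis Ints_0 empty_iff)
    obtain l where l: "l \<in> \<int>" "infdist (y - z) \<int> = dist (y - z) l"
      using infdist_attains_inf[OF closed_Ints_real] by (metis Ints_0 empty_iff)
    have "infdist (x - y) \<int> \<le> dist (x - y) (m - l)"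
      using m l by (intro infdist_le) auto
    also have "\<dots> \<le> dist (x - z) m + dist (y - z) l"
      by (simp add: dist_real_def)
    finally show "infdist (x - y) \<int> \<le> infdist (x - z) \<int> + infdist (y - z) \<int>"
      using m l by simp
  qed
qed

end

lemma dist_torus_of_real:
  "dist (torus_of_real x) (torus_of_real y) = infdist (x - y) \<int>"
  by (rule dist_torus.abs_eq)

lemma dist_torus_of_real_unit:
  assumes "\<bar>x - y\<bar> \<le> 1"
  shows "dist (torus_of_real x) (torus_of_real y) = min \<bar>x - y\<bar> (1 - \<bar>x - y\<bar>)"
proof (rule antisym)
  have ints: "0 \<in> \<int>" "1 \<in> \<int>" "- 1 \<in> (\<int> :: real set)" by auto
  show "dist (torus_of_real x) (torus_of_real y) \<le> min \<bar>x - y\<bar> (1 - \<bar>x - y\<bar>)"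
    using infdist_le[OF ints(1), of "x - y"] infdist_le[OF ints(2), of "x - y"]
      infdist_le[OF ints(3), of "x - y"] assms
    by (auto simp: dist_torus_of_real dist_real_def)
  obtain m where m: "m \<in> \<int>" "infdist (x - y) \<int> = dist (x - y) m"
    using infdist_attains_inf[OF closed_Ints_real] by (metis Ints_0 empty_iff)
  then obtain j :: int where j: "m = of_int j" by (auto elim: Ints_cases)
  consider "j = 0" | "j \<ge> 1" | "j \<le> - 1" by linarith
  then have "min \<bar>x - y\<bar> (1 - \<bar>x - y\<bar>) \<le> \<bar>x - y - of_int j\<bar>"
  proof cases
    case 2
    then have "real_of_int j \<ge> 1" by simp
    then show ?thesis using assms by linarith
  next
    case 3
    then have "real_of_int j \<le> - 1" by linarith
    then show ?thesis using assms by linarith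
  qed simp
  then show "min \<bar>x - y\<bar> (1 - \<bar>x - y\<bar>) \<le> dist (torus_of_real x) (torus_of_real y)"
    using m j by (simp add: dist_torus_of_real dist_real_def)
qed

lemma continuous_on_torus_of_real: "continuous_on A torus_of_real"
proof -
  have "1-lipschitz_on A torus_of_real"
  proof (rule lipschitz_onI)
    fix x y :: real
    show "dist (torus_of_real x) (torus_of_real y) \<le> 1 * dist x y"
      using infdist_le[OF Ints_0, of "x - y"] by (simp add: dist_torus_of_real dist_real_def)
  qed simp
  then show ?thesis by (rule lipschitz_on_continuous_on)
qed

lemma measurable_torus_of_real [measurable]: "torus_of_real \<in> borel_measurable borel"
  by (rule borel_measurable_continuous_onI) (rule continuous_on_torus_of_real)

definition torus_uniform :: "torus measure" where
  "torus_uniform = distr (uniform_measure lborel {0..<1 :: real}) borel torus_of_real"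

lemma prob_space_torus_uniform: "prob_space torus_uniform"
proof -
  interpret U: prob_space "uniform_measure lborel {0..<1 :: real}"
    by (rule prob_space_uniform_measure) auto
  show ?thesis
    unfolding torus_uniform_def by (rule U.prob_space_distr) simp
qed

text \<open>The argument \<open>k\<close> below is the kernel profile for one fixed value of \<open>h\<close>;
  its values at negative reals are irrelevant.  Borel measurability is what makes the
  risk functional and the probabilities of events involving the model meaningful.\<close>

definition kernel_profile :: "real \<Rightarrow> (real \<Rightarrow> real) \<Rightarrow> bool" where
  "kernel_profile h k \<longleftrightarrow>
     set_borel_measurable borel {0..} k \<and>
     (\<forall>t\<ge>0. 0 \<le> k t) \<and>
     closure {t. 0 \<le> t \<and> k t \<noteq> 0} = {0..1 / h} \<and>
     (\<forall>t. 0 \<le> t \<and> t < 1 / h \<longrightarrow> 0 < k t)"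

text \<open>Since \<open>a / 0 = 0\<close>, the model is \<open>0\<close> where the denominator vanishes.\<close>

definition shepard :: "(real \<Rightarrow> real) \<Rightarrow> (torus \<times> real) list \<Rightarrow> torus \<Rightarrow> real" where
  "shepard k z x =
     (\<Sum>(x', y)\<leftarrow>z. k (dist x x') * y) / (\<Sum>(x', y)\<leftarrow>z. k (dist x x'))"

text \<open>Positions in a list count from \<open>0\<close>.\<close>

definition leave_out :: "nat \<Rightarrow> 'a list \<Rightarrow> 'a list" where
  "leave_out i z = take i z @ drop (Suc i) z"

definition risk :: "(torus \<Rightarrow> real) \<Rightarrow> (torus \<Rightarrow> real) \<Rightarrow> real" where
  "risk f g = (LINT x|torus_uniform. \<bar>g x - f x\<bar>\<^sup>2)"

definition cv_score :: "(real \<Rightarrow> real) \<Rightarrow> (torus \<times> real) list \<Rightarrow> real" where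
  "cv_score k z =
     1 / real (length z) *
       (\<Sum>i<length z. \<bar>shepard k (leave_out i z) (fst (z ! i)) - snd (z ! i)\<bar>\<^sup>2)"

definition sup_norm :: "(torus \<Rightarrow> real) \<Rightarrow> real" where
  "sup_norm f = (SUP x. \<bar>f x\<bar>)"

definition sample_list :: "(torus \<Rightarrow> real) \<Rightarrow> nat \<Rightarrow> (nat \<Rightarrow> torus) \<Rightarrow> (torus \<times> real) list" where
  "sample_list f n x = map (\<lambda>i. (x i, f (x i))) [0..<n]"

end

theory Submission
  imports Defs
begin

text \<open>
  At a point with a sample (other than the omitted one) at distance less than \<open>1 / h\<close>, Shepard's model
  averages values of \<open>f\<close> within distance \<open>1 / h\<close>, so its squared error is at most \<open>s = L\<^sup>2 / h\<^sup>2\<close>; at any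
  other point it is at most \<open>max s B\<close> with \<open>B = (sup_norm f)\<^sup>2\<close>.  A given point is of the second kind with
  probability at most \<open>\<kappa> = (max 0 (1 - 2 / h)) ^ (n - 1)\<close>.  Hence \<open>D \<le> max s B\<close>, and Markov's inequality
  gives \<open>(t - s) * P (D > t) \<le> 2 * \<kappa> * B\<close>.  No bounded differences inequality is needed: the
  exponential term exceeds \<open>1\<close> unless \<open>\<epsilon> > 6 * s\<close>, and then, as also \<open>\<epsilon> > 8 * \<gamma> * B\<close>, the bound
  \<open>P (D > \<epsilon>) \<le> 2 * \<gamma>\<close> follows once \<open>\<gamma>\<close> is known to satisfy \<open>1 / 4 \<le> \<gamma>\<close> or \<open>\<kappa> \<le> 7 / 2 * \<gamma>\<^sup>2\<close>.

  This last, deterministic fact is a Bonferroni inequality.  The numbers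
  \<open>q j = (max 0 (1 - j / (2 * h))) ^ (n - 1)\<close> are the probabilities that \<open>j\<close> given spacings of \<open>n\<close> random
  points exceed \<open>1 / (2 * h)\<close>.  So \<open>\<gamma>\<close> is a truncated inclusion-exclusion sum; it is compared with the
  first two factorial moments of the number of such spacings.
\<close>

section \<open>Completely monotone sequences\<close>

text \<open>Of the \<open>n\<close> steps, \<open>k\<close> take a difference and
  \<open>n - k\<close> a shift, in any order. So the condition says that for every
  \<open>k \<le> n\<close> the \<open>k\<close>-th alternating difference of \<open>q\<close> at
  \<open>n - k\<close> is nonnegative. Up to a constant factor these are the sequences
  \<open>q j = P (A_1 \<inter> ... \<inter> A_j)\<close> of \<open>n\<close> exchangeable events;
  the differences are the probabilities that \<open>n - k\<close> given events occur and the other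
  \<open>k\<close> fail.\<close>

primrec completely_monotone :: "nat \<Rightarrow> (nat \<Rightarrow> real) \<Rightarrow> bool" where
  "completely_monotone 0 q \<longleftrightarrow> 0 \<le> q 0"
| "completely_monotone (Suc n) q \<longleftrightarrow>
     completely_monotone n (\<lambda>j. q j - q (Suc j)) \<and> completely_monotone n (\<lambda>j. q (Suc j))"

text \<open>Pascal's rule: apart from the top term, raising \<open>r\<close> by one amounts to
  replacing the coefficients \<open>a j\<close> by \<open>a j + a (Suc j)\<close>.\<close>

lemma sum_binomial_Suc:
  fixes a :: "nat \<Rightarrow> real"
  shows "(\<Sum>j\<le>Suc n. a j * real (Suc r choose j)) =
    (\<Sum>j\<le>n. a j * real (r choose j)) + a (Suc n) * real (r choose Suc n)
      + (\<Sum>j\<le>n. a (Suc j) * real (r choose j))"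
proof -
  have "(\<Sum>j\<le>Suc n. a j * real (Suc r choose j)) =
      a 0 + (\<Sum>j\<le>n. a (Suc j) * real (r choose Suc j)) + (\<Sum>j\<le>n. a (Suc j) * real (r choose j))"
    by (subst sum.atMost_Suc_shift) (simp add: sum.distrib algebra_simps)
  also have "a 0 + (\<Sum>j\<le>n. a (Suc j) * real (r choose Suc j)) = (\<Sum>j\<le>Suc n. a j * real (r choose j))"
    by (subst sum.atMost_Suc_shift) simp
  finally show ?thesis by simp
qed

text \<open>For exchangeable events the sum is the expectation of \<open>p N\<close>, where
  \<open>N\<close> counts the events that occur and
  \<open>p r = (\<Sum>j\<le>n. a j * real (r choose j))\<close>. The induction conditions on one
  event: if it fails, \<open>p\<close> is kept; if it occurs, \<open>p r\<close> becomes
  \<open>p (Suc r)\<close>, with coefficients \<open>a j + a (Suc j)\<close>.\<close>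

lemma completely_monotone_binomial_sum_nonneg_aux:
  assumes "completely_monotone n q"
    and "\<And>r. r \<le> n \<Longrightarrow> 0 \<le> (\<Sum>j\<le>n. a j * real (r choose j))"
  shows "0 \<le> (\<Sum>j\<le>n. a j * real (n choose j) * q j)"
  using assms
proof (induction n arbitrary: q a)
  case 0
  from "0.prems"(2)[of 0] have "0 \<le> a 0" by simp
  with 0 show ?case by simp
next
  case (Suc n)
  have "(\<Sum>j\<le>Suc n. a j * real (Suc n choose j) * q j) =
      (\<Sum>j\<le>Suc n. (a j * q j) * real (Suc n choose j))"
    by (simp only: mult_ac)
  also have "\<dots> = (\<Sum>j\<le>n. a j * real (n choose j) * (q j - q (Suc j)))
      + (\<Sum>j\<le>n. (a j + a (Suc j)) * real (n choose j) * q (Suc j))"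
    unfolding sum_binomial_Suc by (simp add: sum.distrib[symmetric] algebra_simps)
  finally have eq: "(\<Sum>j\<le>Suc n. a j * real (Suc n choose j) * q j) =
      (\<Sum>j\<le>n. a j * real (n choose j) * (q j - q (Suc j)))
      + (\<Sum>j\<le>n. (a j + a (Suc j)) * real (n choose j) * q (Suc j))" .
  have "0 \<le> (\<Sum>j\<le>n. a j * real (r choose j))" if "r \<le> n" for r
    using Suc.prems(2)[of r] that by (simp add: binomial_eq_0)
  then have 1: "0 \<le> (\<Sum>j\<le>n. a j * real (n choose j) * (q j - q (Suc j)))"
    using Suc.prems(1) by (intro Suc.IH) auto
  have "0 \<le> (\<Sum>j\<le>n. (a j + a (Suc j)) * real (r choose j))" if "r \<le> n" for r
    using Suc.prems(2)[of "Suc r"] that unfolding sum_binomial_Suc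
    by (simp add: sum.distrib[symmetric] algebra_simps binomial_eq_0)
  then have "0 \<le> (\<Sum>j\<le>n. (a j + a (Suc j)) * real (n choose j) * q (Suc j))"
    using Suc.prems(1) by (intro Suc.IH) auto
  with 1 eq show ?case by simp
qed

text \<open>The degree \<open>m\<close> may differ from \<open>n\<close>: cutting or padding the
  coefficients to length \<open>n\<close> changes nothing, because \<open>r choose j\<close> is
  \<open>0\<close> for \<open>j > r\<close> and only \<open>r \<le> n\<close> enters.\<close>

lemma completely_monotone_binomial_sum_nonneg:
  assumes "completely_monotone n q"
    and "\<And>r. 0 \<le> (\<Sum>j\<le>m. a j * real (r choose j))"
  shows "0 \<le> (\<Sum>j\<le>m. a j * real (n choose j) * q j)"
proof -
  define a' where "a' j = (if j \<le> m then a j else 0)" for j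
  have eq: "(\<Sum>j\<le>m. a j * real (r choose j) * f j) = (\<Sum>j\<le>n. a' j * real (r choose j) * f j)"
    if "r \<le> n" for r f
  proof -
    have "(\<Sum>j\<le>m. a j * real (r choose j) * f j) = (\<Sum>j\<le>min m n. a j * real (r choose j) * f j)"
      using that by (intro sum.mono_neutral_right) auto
    also have "\<dots> = (\<Sum>j\<le>n. a' j * real (r choose j) * f j)"
      by (intro sum.mono_neutral_cong_left) (auto simp: a'_def)
    finally show ?thesis .
  qed
  show ?thesis
    unfolding eq[OF order_refl]
  proof (rule completely_monotone_binomial_sum_nonneg_aux[OF assms(1)])
    fix r assume "r \<le> n"
    from eq[OF this, of "\<lambda>_. 1"] assms(2)[of r]
    show "0 \<le> (\<Sum>j\<le>n. a' j * real (r choose j))" by simp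
  qed
qed

section \<open>Iterated differences of truncated powers\<close>

definition backward_diff :: "real \<Rightarrow> (real \<Rightarrow> real) \<Rightarrow> real \<Rightarrow> real" where
  "backward_diff a g y = g y - g (y - a)"

text \<open>A difference of the sampled sequence replaces \<open>g\<close> by its backward
  difference, and a shift replaces \<open>y\<close> by \<open>y - a\<close>, so both recursive
  conditions are again of the assumed form.\<close>

lemma completely_monotone_backward_diff:
  assumes "\<And>k y. k \<le> n \<Longrightarrow> 0 \<le> (backward_diff a ^^ k) g y"
  shows "completely_monotone n (\<lambda>j. g (y - real j * a))"
  using assms
proof (induction n arbitrary: g y)
  case 0
  from "0.prems"[of 0 y] show ?case by simp
next
  case (Suc n)
  have "completely_monotone n (\<lambda>j. backward_diff a g (y - real j * a))"
  proof (rule Suc.IH)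
    fix k z assume "k \<le> n"
    then show "0 \<le> (backward_diff a ^^ k) (backward_diff a g) z"
      using Suc.prems[of "Suc k" z] by (simp add: funpow_swap1)
  qed
  moreover have "completely_monotone n (\<lambda>j. g ((y - a) - real j * a))"
    using Suc.prems by (intro Suc.IH) auto
  ultimately show ?case by (simp add: backward_diff_def algebra_simps)
qed

lemma backward_diff_power_cmult:
  "(backward_diff a ^^ k) (\<lambda>y. c * g y) = (\<lambda>y. c * (backward_diff a ^^ k) g y)"
  by (induction k) (auto simp: backward_diff_def fun_eq_iff algebra_simps)

lemma has_real_derivative_backward_diff_power:
  assumes "\<And>y. (g has_real_derivative g' y) (at y)"
  shows "((backward_diff a ^^ k) g has_real_derivative (backward_diff a ^^ k) g' y) (at y)"
proof (induction k arbitrary: y)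
  case (Suc k)
  have "((\<lambda>y. (backward_diff a ^^ k) g (y - a)) has_real_derivative
      (backward_diff a ^^ k) g' (y - a)) (at y)"
    using DERIV_shift[of "(backward_diff a ^^ k) g" "(backward_diff a ^^ k) g' (y - a)" y "- a"]
      Suc.IH[of "y - a"] by simp
  from DERIV_diff[OF Suc.IH this] show ?case by (simp add: backward_diff_def[abs_def])
qed (use assms in simp)

lemma backward_diff_power_nonpos_zero:
  assumes "\<And>y. y \<le> 0 \<Longrightarrow> g y = 0" and "0 \<le> a" and "y \<le> 0"
  shows "(backward_diff a ^^ k) g y = 0"
  using assms(3)
  by (induction k arbitrary: y) (use assms(1,2) in \<open>auto simp: backward_diff_def\<close>)

lemma has_real_derivative_positive_part_power:
  "((\<lambda>y. (max 0 y) ^ Suc (Suc p)) has_real_derivative (real (Suc (Suc p)) * (max 0 y) ^ Suc p)) (at y)"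
proof -
  consider "y < 0" | "y > 0" | "y = 0" by linarith
  then show ?thesis
  proof cases
    case 1
    have "((\<lambda>y. 0) has_real_derivative (real (Suc (Suc p)) * (max 0 y) ^ Suc p)) (at y)"
      using 1 by simp
    then show ?thesis
      by (rule has_field_derivative_transform_within_open[of _ _ _ "{..<0}"]) (use 1 in auto)
  next
    case 2
    have "((\<lambda>y. y ^ Suc (Suc p)) has_real_derivative (real (Suc (Suc p)) * (max 0 y) ^ Suc p)) (at y)"
      using 2 DERIV_pow[of "Suc (Suc p)" y] by (simp add: max_def)
    then show ?thesis
      by (rule has_field_derivative_transform_within_open[of _ _ _ "{0<..}"]) (use 2 in auto)
  next
    case 3
    have lim: "((\<lambda>h. (max 0 h) ^ Suc p) \<longlongrightarrow> (max 0 0) ^ Suc p) (at (0::real))"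
      by (intro tendsto_intros)
    have "((\<lambda>h. ((max 0 (0 + h)) ^ Suc (Suc p) - (max 0 0) ^ Suc (Suc p)) / h) \<longlongrightarrow> 0) (at (0::real))"
    proof (rule Lim_transform_eventually)
      show "((\<lambda>h. (max 0 h) ^ Suc p) \<longlongrightarrow> 0) (at (0::real))" using lim by simp
      show "\<forall>\<^sub>F h in at (0::real). (max 0 h) ^ Suc p = ((max 0 (0 + h)) ^ Suc (Suc p) - (max 0 0) ^ Suc (Suc p)) / h"
        by (auto simp: eventually_at_filter max_def)
    qed
    then show ?thesis using 3 by (simp add: DERIV_def)
  qed
qed

text \<open>For \<open>k = p + 2\<close> this is, up to scaling, the nonnegativity of B-splines of
  degree \<open>p + 1\<close>. Differentiation commutes with differences and lowers the exponent.
  Hence, for the next exponent, the differences of order at most \<open>p + 2\<close> are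
  nondecreasing, and they vanish on the negative axis. The one remaining order is a difference of
  such a nondecreasing function.\<close>

lemma backward_diff_power_positive_part_nonneg:
  assumes "0 < a" and "k \<le> Suc (Suc p)"
  shows "0 \<le> (backward_diff a ^^ k) (\<lambda>y. (max 0 y) ^ Suc p) y"
  using assms(2)
proof (induction p arbitrary: k y)
  case 0
  then consider "k = 0" | "k = 1" | "k = 2" by linarith
  then show ?case
    using assms(1) by cases (auto simp: backward_diff_def max_def numeral_2_eq_2)
next
  case (Suc p)
  let ?g = "\<lambda>y::real. (max 0 y) ^ Suc (Suc p)"
  have nondecreasing: "(backward_diff a ^^ k) ?g y \<le> (backward_diff a ^^ k) ?g z"
    if "k \<le> Suc (Suc p)" "y \<le> z" for k y z
  proof (rule DERIV_nonneg_imp_nondecreasing[OF that(2)])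
    fix x
    have "((backward_diff a ^^ k) ?g has_real_derivative
        real (Suc (Suc p)) * (backward_diff a ^^ k) (\<lambda>y. (max 0 y) ^ Suc p) x) (at x)"
      using has_real_derivative_backward_diff_power[OF has_real_derivative_positive_part_power]
      by (simp only: backward_diff_power_cmult)
    then show "\<exists>d. ((backward_diff a ^^ k) ?g has_real_derivative d) (at x) \<and> 0 \<le> d"
      using Suc.IH[OF that(1), of x] by (intro exI conjI) (assumption, simp del: power_Suc)
  qed
  show ?case
  proof (cases "k \<le> Suc (Suc p)")
    case True
    have "(backward_diff a ^^ k) ?g (min 0 y) = 0"
      using assms(1) by (intro backward_diff_power_nonpos_zero) auto
    then show ?thesis
      using nondecreasing[OF True, of "min 0 y" y] by simp
  next
    case False
    with Suc.prems have k: "k = Suc (Suc (Suc p))" by simp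
    have "(backward_diff a ^^ k) ?g y =
        (backward_diff a ^^ Suc (Suc p)) ?g y - (backward_diff a ^^ Suc (Suc p)) ?g (y - a)"
      unfolding k by (subst funpow.simps(2)) (simp only: comp_def backward_diff_def[of a _ y])
    then show ?thesis
      using nondecreasing[of "Suc (Suc p)" "y - a" y] assms(1) by linarith
  qed
qed

lemma completely_monotone_positive_part_power:
  assumes "0 < a" and "2 \<le> n"
  shows "completely_monotone n (\<lambda>j. (max 0 (1 - real j * a)) ^ (n - 1))"
proof -
  obtain p where n: "n = Suc (Suc p)"
    using assms(2) by (metis add_2_eq_Suc le_Suc_ex)
  show ?thesis
    using completely_monotone_backward_diff[of n a "\<lambda>y. (max 0 y) ^ Suc p" 1]
      backward_diff_power_positive_part_nonneg[OF assms(1)]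
    by (simp add: n)
qed

section \<open>A Bonferroni inequality for odd truncations\<close>

text \<open>The sum from \<open>j = 0\<close> collapses to
  \<open>(-1) ^ m * (r - 1 choose m)\<close>, so for odd \<open>m\<close> the sum from
  \<open>j = 1\<close> equals \<open>1 + (r - 1 choose m)\<close>.\<close>

lemma odd_alternating_binomial_sum_ge_1:
  assumes "odd m" and "1 \<le> r"
  shows "1 \<le> (\<Sum>j = 1..m. (-1) ^ (j + 1) * real (r choose j))"
proof -
  have "(\<Sum>j\<le>m. real (r choose j) * (-1) ^ j) = (-1) ^ m * ((real r - 1) gchoose m)"
    using gbinomial_sum_lower_neg[of "real r" m] by (simp add: binomial_gbinomial)
  also have "real r - 1 = real (r - 1)"
    using assms(2) by simp
  finally have "(\<Sum>j\<le>m. real (r choose j) * (-1) ^ j) = - real (r - 1 choose m)"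
    using assms(1) by (simp add: binomial_gbinomial)
  moreover have "(\<Sum>j\<le>m. real (r choose j) * (-1) ^ j) =
      1 + (\<Sum>j = 1..m. real (r choose j) * (-1) ^ j)"
    by (simp add: atMost_atLeast0 sum.atLeast_Suc_atMost)
  moreover have "(\<Sum>j = 1..m. (-1) ^ (j + 1) * real (r choose j)) =
      - (\<Sum>j = 1..m. real (r choose j) * (-1) ^ j)"
    by (simp add: sum_negf[symmetric] mult.commute)
  ultimately show ?thesis by simp
qed

lemma two_mult_choose_two: "2 * real (r choose 2) = real r * (real r - 1)"
proof -
  have "even (r * (r - 1))" by (cases r) auto
  then have "2 * (r choose 2) = r * (r - 1)" by (simp add: choose_two)
  then have "2 * real (r choose 2) = real (r * (r - 1))" by (metis of_nat_mult of_nat_numeral)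
  then show ?thesis by (cases r) (auto simp: algebra_simps)
qed

text \<open>Let \<open>N\<close> count the occurring events. An odd truncation of
  inclusion-exclusion overestimates \<open>P (N \<ge> 1)\<close>, which is at least
  \<open>E[N] ^ 2 / E[N ^ 2]\<close>. Here \<open>E[N] = T\<close>, and
  \<open>q 2 \<le> (q 1) ^ 2\<close> gives \<open>E[N ^ 2] \<le> T + T ^ 2\<close>.\<close>

lemma odd_alternating_sum_ge:
  fixes q :: "nat \<Rightarrow> real"
  assumes cm: "completely_monotone n q" and "odd m" and "q 2 \<le> (q 1)\<^sup>2" and "0 \<le> q 1"
  defines "T \<equiv> real n * q 1"
  shows "T / (1 + T) \<le> (\<Sum>j = 1..m. (-1) ^ (j + 1) * real (n choose j) * q j)"
proof -
  \<comment> \<open>The coefficients \<open>a\<close> below encode \<open>1 \<ge> 1 - (1 - t * r)\<^sup>2\<close> for \<open>r \<ge> 1\<close> in the binomial basis;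
    \<open>t = 1 / (1 + T)\<close> is the optimal parameter of this second moment bound.\<close>
  define t where "t = 1 / (1 + T)"
  have T: "0 \<le> T" using assms(4) by (simp add: T_def)
  define a where "a j = (if j \<in> {1..m} then (-1) ^ (j + 1) else 0)
    - (if j = 1 then 2 * t - t\<^sup>2 else 0) + (if j = 2 then 2 * t\<^sup>2 else 0)" for j :: nat
  have m: "1 \<le> m" using assms(2) by (cases m) auto
  have eq: "(\<Sum>j\<le>Suc m. a j * f j) =
      (\<Sum>j = 1..m. (-1) ^ (j + 1) * f j) - (2 * t - t\<^sup>2) * f 1 + 2 * t\<^sup>2 * f 2" for f
  proof -
    have "(\<Sum>j\<le>Suc m. a j * f j) = (\<Sum>j\<le>Suc m. if j \<in> {1..m} then (-1) ^ (j + 1) * f j else 0)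
       - (\<Sum>j\<le>Suc m. if j = 1 then (2 * t - t\<^sup>2) * f 1 else 0)
       + (\<Sum>j\<le>Suc m. if j = 2 then 2 * t\<^sup>2 * f 2 else 0)"
      unfolding sum_subtractf[symmetric] sum.distrib[symmetric]
      by (intro sum.cong refl) (auto simp: a_def algebra_simps)
    also have "(\<Sum>j\<le>Suc m. if j \<in> {1..m} then (-1) ^ (j + 1) * f j else 0) = (\<Sum>j = 1..m. (-1) ^ (j + 1) * f j)"
      by (intro sum.mono_neutral_cong_right) auto
    finally show ?thesis using m by simp
  qed
  have "0 \<le> (\<Sum>j\<le>Suc m. a j * real (n choose j) * q j)"
  proof (rule completely_monotone_binomial_sum_nonneg[OF cm])
    fix r
    have "(\<Sum>j\<le>Suc m. a j * real (r choose j)) =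
        (\<Sum>j = 1..m. (-1) ^ (j + 1) * real (r choose j)) - (2 * t - t\<^sup>2) * real r
          + t\<^sup>2 * (real r * (real r - 1))"
      unfolding eq two_mult_choose_two[symmetric] by simp
    also have "\<dots> = (\<Sum>j = 1..m. (-1) ^ (j + 1) * real (r choose j)) - 1 + (1 - t * real r)\<^sup>2"
      by (simp add: power2_eq_square algebra_simps)
    finally have *: "(\<Sum>j\<le>Suc m. a j * real (r choose j)) =
        (\<Sum>j = 1..m. (-1) ^ (j + 1) * real (r choose j)) - 1 + (1 - t * real r)\<^sup>2" .
    show "0 \<le> (\<Sum>j\<le>Suc m. a j * real (r choose j))"
    proof (cases "r = 0")
      case True
      then show ?thesis unfolding * by (simp add: binomial_eq_0)
    next
      case False
      then show ?thesis
        unfolding * using odd_alternating_binomial_sum_ge_1[OF assms(2), of r] by simp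
    qed
  qed
  then have "(2 * t - t\<^sup>2) * T - t\<^sup>2 * (2 * real (n choose 2) * q 2)
      \<le> (\<Sum>j = 1..m. (-1) ^ (j + 1) * real (n choose j) * q j)"
    using eq[of "\<lambda>j. real (n choose j) * q j"] by (simp add: T_def mult.assoc)
  moreover have "t\<^sup>2 * (2 * real (n choose 2) * q 2) \<le> t\<^sup>2 * T\<^sup>2"
  proof (rule mult_left_mono)
    have "2 * real (n choose 2) * q 2 \<le> 2 * real (n choose 2) * (q 1)\<^sup>2"
      using assms(3) by (intro mult_left_mono) auto
    also have "\<dots> \<le> (real n * real n) * (q 1)\<^sup>2"
      unfolding two_mult_choose_two by (intro mult_right_mono mult_left_mono) auto
    finally show "2 * real (n choose 2) * q 2 \<le> T\<^sup>2"
      by (simp add: T_def power2_eq_square algebra_simps)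
  qed simp
  moreover have "(2 * t - t\<^sup>2) * T - t\<^sup>2 * T\<^sup>2 = T / (1 + T)"
  proof -
    have "t * (1 + T) = 1" using T by (simp add: t_def)
    moreover have "(2 * t - t\<^sup>2) * T - t\<^sup>2 * T\<^sup>2 = 2 * t * T - t * T * (t * (1 + T))"
      by (simp add: power2_eq_square algebra_simps)
    ultimately show ?thesis by (simp add: t_def)
  qed
  ultimately show ?thesis by linarith
qed

section \<open>Numerical bounds for binomials and powers\<close>

text \<open>Row \<open>9\<close> is the first in which every entry is at most a quarter of the row
  sum (\<open>4 * 126 = 504 \<le> 512\<close>), and Pascal's rule passes this on to all later rows.
  In the rows up to \<open>8\<close> the bound fails only for some \<open>k < 5\<close>.\<close>

lemma binomial_le_quarter_power2:
  assumes "5 \<le> k"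
  shows "4 * real (n choose k) \<le> 2 ^ n"
proof -
  have large: "4 * real (n choose k) \<le> 2 ^ n" if "9 \<le> n" for n k
    using that
  proof (induction n arbitrary: k rule: dec_induct)
    case base
    have "k \<in> {0,1,2,3,4,5,6,7,8,9} \<or> 9 < k" by auto
    then show ?case
      by (elim disjE insertE) (simp_all add: binomial_fact fact_numeral binomial_eq_0)
  next
    case (step n)
    show ?case
    proof (cases k)
      case 0
      then show ?thesis using step.hyps power_increasing[of 1 n "2 :: real"] by simp
    next
      case (Suc k')
      then show ?thesis using step.IH[of k] step.IH[of k'] by simp
    qed
  qed
  show ?thesis
  proof (cases "n \<le> 8 \<and> k \<le> n")
    case True
    have "n \<in> {5,6,7,8}" using assms True by simp presburger
    moreover have "k \<in> {5,6,7,8}" using assms True by simp presburger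
    ultimately show ?thesis using True[THEN conjunct2]
      by (elim insertE emptyE; hypsubst) (simp_all add: binomial_fact fact_numeral)
  next
    case False
    then show ?thesis using large[of n k] by (cases "n < k") (auto simp: binomial_eq_0)
  qed
qed

lemma power_over_fact_antimono:
  fixes T :: real
  assumes "k \<le> m" and "0 \<le> T" and "T \<le> real k"
  shows "T ^ m / fact m \<le> T ^ k / fact k"
  using assms(1)
proof (induction m rule: dec_induct)
  case (step m)
  have "T ^ Suc m / fact (Suc m) = (T ^ m / fact m) * (T / real (Suc m))"
    by (simp add: field_simps)
  also have "\<dots> \<le> (T ^ m / fact m) * 1"
    using step.hyps assms(2,3) by (intro mult_left_mono) (auto simp: field_simps)
  finally show ?case using step.IH by simp
qed simp

text \<open>The maximum \<open>1024 / 625\<close> is attained at \<open>k = 4\<close> and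
  \<open>k = 5\<close>; from there on the ratio of consecutive terms is at most
  \<open>1\<close>.\<close>

lemma mult_four_fifths_power_le: "real k * (4 / 5) ^ k \<le> 41 / 25"
proof (cases "k \<le> 4")
  case True
  then have "k \<in> {0,1,2,3,4}" by auto
  then show ?thesis by (elim insertE) (auto simp: power_divide)
next
  case False
  then have "5 \<le> k" by simp
  then show ?thesis
  proof (induction k rule: dec_induct)
    case base
    then show ?case by (simp add: power_divide)
  next
    case (step k)
    have "real (Suc k) * (4 / 5) ^ Suc k = (real (Suc k) * (4 / 5)) * (4 / 5) ^ k" by simp
    also have "\<dots> \<le> real k * (4 / 5) ^ k"
      using step.hyps by (intro mult_right_mono) auto
    also note step.IH
    finally show ?case .
  qed
qed

section \<open>The lower bound for the alternating sum\<close>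

text \<open>The Bonferroni bound \<open>T / (1 + T)\<close> with
  \<open>T = n * (1 - a) ^ (n - 1)\<close> and \<open>a = 1 / (2 * h)\<close> applies to \<gamma>
  directly if the number of summands is odd, and after adding one more summand if it is even. For
  small \<open>T\<close> this makes \<gamma> comparable to \<open>T\<close>, which yields the bound
  on \<kappa>; for large \<open>T\<close> it mostly yields
  \<open>1 / 4 \<le> \<gamma>\<close>.\<close>

lemma alternating_gap_sum_lower_bound:
  fixes h :: real and n :: nat
  assumes n: "3 \<le> n" and h: "0 < h"
  defines "\<gamma> \<equiv> (\<Sum>j = 1..nat \<lfloor>h\<rfloor>.
      (-1) ^ (j + 1) * real (n choose j) * (1 - real j / (2 * h)) ^ (n - 1))"
    and "\<kappa> \<equiv> (max 0 (1 - 2 / h)) ^ (n - 1)"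
  shows "0 \<le> \<gamma> \<and> (1 / 4 \<le> \<gamma> \<or> \<kappa> \<le> 7 / 2 * \<gamma>\<^sup>2)"
proof (cases "h < 1")
  case True
  then have "1 - 2 / h < 0" using h by (simp add: field_simps)
  moreover have "nat \<lfloor>h\<rfloor> = 0" using True h by linarith
  ultimately show ?thesis using n by (simp add: \<gamma>_def \<kappa>_def power_0_left)
next
  case False
  define m where "m = nat \<lfloor>h\<rfloor>"
  have m: "1 \<le> m" "real m \<le> h" "h < real (Suc m)"
    using False unfolding m_def by linarith+
  define a where "a = 1 / (2 * h)"
  have a: "0 < a" "a \<le> 1 / 2" "2 / h = 4 * a" "real m * a \<le> 1 / 2" "1 / 2 < real (Suc m) * a"
    using False m unfolding a_def by (auto simp: field_simps)
  \<comment> \<open>The positive part makes \<open>q\<close> completely monotone along all indices.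
    It is inactive for \<open>j \<le> m\<close>, where \<open>1 - j * a\<close> is at least
    \<open>1 / 2\<close>.\<close>
  define q where "q j = (max 0 (1 - real j * a)) ^ (n - 1)" for j
  define \<beta> where "\<beta> = (1 - a) ^ (n - 1)"
  define S where "S m = (\<Sum>j = 1..m. (-1) ^ (j + 1) * real (n choose j) * q j)" for m
  have cm: "completely_monotone n q"
    unfolding q_def[abs_def] using a n by (intro completely_monotone_positive_part_power) auto
  have \<gamma>: "\<gamma> = S m"
    unfolding \<gamma>_def S_def m_def[symmetric]
  proof (intro sum.cong refl)
    fix j assume "j \<in> {1..m}"
    then have "real j \<le> 2 * h" using m h by (auto dest!: of_nat_mono[where 'a = real])
    then have "max 0 (1 - real j * a) = 1 - real j / (2 * h)"
      using h by (simp add: a_def field_simps)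
    then show "(-1) ^ (j + 1) * real (n choose j) * (1 - real j / (2 * h)) ^ (n - 1) =
        (-1) ^ (j + 1) * real (n choose j) * q j"
      by (simp only: q_def)
  qed
  have q1: "q 1 = \<beta>" using a by (simp add: q_def \<beta>_def max_def)
  have \<beta>: "0 < \<beta>" using a by (simp add: \<beta>_def)
  define T where "T = real n * \<beta>"
  have T: "0 < T" "3 * \<beta> \<le> T" using \<beta> n by (auto simp: T_def)
  have q_nonneg: "0 \<le> q j" for j by (simp add: q_def)
  have q_le_power: "q j \<le> \<beta> ^ j" for j
  proof -
    have "max 0 (1 - real j * a) \<le> (1 - a) ^ j"
      using Bernoulli_inequality[of "-a" j] a by simp
    then have "q j \<le> ((1 - a) ^ j) ^ (n - 1)"
      unfolding q_def by (intro power_mono) auto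
    then show ?thesis by (simp add: \<beta>_def power_mult[symmetric] mult.commute)
  qed
  have odd_bound: "T / (1 + T) \<le> S k" if "odd k" for k
    using odd_alternating_sum_ge[OF cm that] q_le_power[of 2] \<beta> unfolding q1 S_def T_def by simp
  have "1 - 4 * a \<le> (1 - a)\<^sup>2"
    using a(1) by (simp add: power2_eq_square algebra_simps)
  then have "max 0 (1 - 4 * a) \<le> (1 - a)\<^sup>2"
    by simp
  then have "\<kappa> \<le> ((1 - a)\<^sup>2) ^ (n - 1)"
    unfolding \<kappa>_def a(3) by (intro power_mono) auto
  then have \<kappa>: "\<kappa> \<le> \<beta>\<^sup>2"
    by (simp add: \<beta>_def power_mult[symmetric] mult.commute)
  \<comment> \<open>The factor \<open>9 / 50\<close> is what the case \<open>m = 2\<close> provides.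
    It suffices, as \<open>3 * \<beta> \<le> T\<close> turns it into
    \<open>27 / 50 * \<beta> \<le> \<gamma>\<close>, and \<open>7 / 2 * (27 / 50) ^ 2\<close>
    exceeds \<open>1\<close>.\<close>
  have goal_if: "0 \<le> \<gamma> \<and> (1 / 4 \<le> \<gamma> \<or> \<kappa> \<le> 7 / 2 * \<gamma>\<^sup>2)" if "9 / 50 * T \<le> \<gamma>"
  proof -
    have "27 / 50 * \<beta> \<le> \<gamma>" using that T by linarith
    then have "(27 / 50 * \<beta>)\<^sup>2 \<le> \<gamma>\<^sup>2" using \<beta> by (intro power_mono) auto
    then have "729 / 2500 * \<beta>\<^sup>2 \<le> \<gamma>\<^sup>2" by (simp add: power_mult_distrib power_divide)
    then have "\<beta>\<^sup>2 \<le> 7 / 2 * \<gamma>\<^sup>2" using zero_le_power2[of \<beta>] by linarith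
    then show ?thesis using \<kappa> that T by auto
  qed
  show ?thesis
  proof (cases "odd m")
    case True
    note bound = odd_bound[OF True]
    show ?thesis
    proof (cases "T \<le> 1")
      case True
      have "T * (1 / 2) \<le> T * (1 / (1 + T))"
        using T True by (intro mult_left_mono) (auto simp: field_simps)
      then show ?thesis using bound T by (intro goal_if) (simp add: \<gamma>)
    next
      case False
      then have "1 / 2 \<le> T / (1 + T)" by (simp add: field_simps)
      then have "1 / 2 \<le> \<gamma>" using bound unfolding \<gamma> by linarith
      then show ?thesis by simp
    qed
  next
    case m_even: False
    define M where "M = Suc m"
    define \<tau> where "\<tau> = real (n choose M) * q M"
    \<comment> \<open>Dropping the last term \<open>\<tau>\<close> of an odd truncation costs nearly \<open>1 / 2\<close> when \<open>n\<close> is close to \<open>2 * M\<close>,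
      so \<open>m = 2\<close> and the ranges of \<open>T\<close> below need separate estimates.\<close>
    have "odd M" using m_even by (simp add: M_def)
    have "S M = S m + \<tau>"
      using m_even by (simp add: M_def S_def \<tau>_def)
    then have bound: "T / (1 + T) - \<tau> \<le> \<gamma>"
      using odd_bound[OF \<open>odd M\<close>] by (simp add: \<gamma>)
    have "max 0 (1 - real M * a) \<le> 1 / 2"
      using a(5) unfolding M_def by (intro max.boundedI) linarith+
    then have "q M \<le> (1 / 2) ^ (n - 1)"
      unfolding q_def by (intro power_mono) simp_all
    then have \<tau>_binomial: "\<tau> \<le> real (n choose M) * (1 / 2) ^ (n - 1)"
      unfolding \<tau>_def by (intro mult_left_mono) auto
    show ?thesis
    proof (cases "m = 2")
      case True
      have "\<gamma> = T - real (n choose 2) * q 2"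
        unfolding \<gamma> S_def True T_def by (simp add: numeral_2_eq_2 q1[simplified])
      moreover have "real (n choose 2) * q 2 \<le> 41 / 50 * T"
      proof -
        \<comment> \<open>Here \<open>h < 3\<close>, that is \<open>a > 1 / 6\<close>, and
          \<open>a = 1 / 6\<close> is where \<open>1 - 2 * a\<close> equals
          \<open>4 / 5 * (1 - a)\<close>.\<close>
        have "max 0 (1 - 2 * a) \<le> 4 / 5 * (1 - a)"
          using a True by auto
        then have "q 2 \<le> (4 / 5 * (1 - a)) ^ (n - 1)"
          unfolding q_def by (intro power_mono) auto
        then have "q 2 \<le> (4 / 5) ^ (n - 1) * \<beta>"
          unfolding \<beta>_def power_mult_distrib .
        then have "real (n choose 2) * q 2 \<le> real (n choose 2) * ((4 / 5) ^ (n - 1) * \<beta>)"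
          by (rule mult_left_mono) simp
        also have "\<dots> = T / 2 * (real (n - 1) * (4 / 5) ^ (n - 1))"
        proof -
          have "real (n choose 2) = real n * real (n - 1) / 2"
            using two_mult_choose_two[of n] n by simp
          then show ?thesis by (simp add: T_def)
        qed
        also have "\<dots> \<le> T / 2 * (41 / 25)"
          using T by (intro mult_left_mono mult_four_fifths_power_le) auto
        finally show ?thesis by simp
      qed
      ultimately show ?thesis by (intro goal_if) simp
    next
      case False
      have M5: "5 \<le> M"
        using False m_even m(1) unfolding M_def by presburger
      \<comment> \<open>The bounds \<open>n ^ M / M!\<close> for the binomial and
        \<open>\<beta> ^ M\<close> for \<open>q M\<close> combine to \<open>T ^ M / M!\<close>. The
        exponent may be lowered as long as it stays at least \<open>T\<close>.\<close>
      have \<tau>_power: "\<tau> \<le> T ^ k / fact k" if "k \<le> M" "T \<le> real k" for k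
      proof -
        have "real (n choose M) * fact M \<le> real n ^ M"
          using binomial_fact_pow[of n M] by (metis of_nat_fact of_nat_le_iff of_nat_mult of_nat_power)
        then have "real (n choose M) \<le> real n ^ M / fact M"
          by (simp add: field_simps)
        then have "\<tau> \<le> real n ^ M / fact M * \<beta> ^ M"
          unfolding \<tau>_def using q_le_power[of M] q_nonneg by (intro mult_mono) auto
        also have "\<dots> = T ^ M / fact M" by (simp add: T_def power_mult_distrib)
        also have "\<dots> \<le> T ^ k / fact k"
          using that T by (intro power_over_fact_antimono) auto
        finally show ?thesis .
      qed
      have "4 * real (n choose M) \<le> 2 ^ n"
        by (rule binomial_le_quarter_power2[OF M5])
      moreover obtain n' where n': "n = Suc n'" using n by (cases n) auto
      ultimately have "real (n choose M) * (1 / 2) ^ (n - 1) \<le> 1 / 2"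
        by (simp add: power_divide field_simps)
      then have \<tau>_half: "\<tau> \<le> 1 / 2"
        using \<tau>_binomial by linarith
      have T_ge: "c / (1 + c) \<le> T / (1 + T)" if "0 \<le> c" "c \<le> T" for c
        using that T by (simp add: field_simps)
      have le_quarter: ?thesis if "0 \<le> c" "c \<le> T" "1 / 4 + \<tau> \<le> c / (1 + c)" for c
        using T_ge[OF that(1,2)] that(3) bound by auto
      have power5: "\<tau> \<le> c ^ 5 / 120" if "T \<le> c" "c \<le> 5" for c
      proof -
        have "T ^ 5 \<le> c ^ 5" using that T by (intro power_mono) auto
        then show ?thesis using \<tau>_power[OF M5] that by (simp add: fact_numeral)
      qed
      \<comment> \<open>For \<open>T \<ge> 3\<close>, \<open>T / (1 + T) \<ge> 3 / 4\<close> exceeds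
        \<open>\<tau> \<le> 1 / 2\<close> by \<open>1 / 4\<close>; for \<open>T \<le> 1\<close>,
        \<tau> is at most \<open>T / 120\<close>. In between, on each range the left end bounds
        \<open>T / (1 + T)\<close> from below and the right end bounds \<tau>. The estimate
        \<open>T ^ 5 / 120\<close> is good enough only up to about \<open>T = 2\<close>; beyond that
        \<open>T ^ 7 / 5040\<close> is used, and \<open>M = 5\<close> is split according to
        \<open>n\<close>.\<close>
      consider "T \<le> 1" | "1 \<le> T" "T \<le> 3 / 2" | "3 / 2 \<le> T" "T \<le> 2"
        | "2 \<le> T" "T \<le> 5 / 2" "7 \<le> M" | "5 / 2 \<le> T" "T \<le> 3" "7 \<le> M"
        | "2 \<le> T" "M = 5" "n \<le> 6" | "2 \<le> T" "M = 5" "7 \<le> n" | "3 \<le> T"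
        using M5 \<open>odd M\<close> by (cases "M = 5"; cases "M = 6") force+
      then show ?thesis
      proof cases
        case 1
        have "T * (1 / 2) \<le> T * (1 / (1 + T))"
          using T 1 by (intro mult_left_mono) (auto simp: field_simps)
        moreover have "T ^ 5 \<le> T ^ 1"
          using T 1 by (intro power_decreasing) auto
        ultimately have "9 / 50 * T \<le> \<gamma>"
          using \<tau>_power[OF M5] 1 T bound by (simp add: fact_numeral)
        then show ?thesis by (rule goal_if)
      next
        case 2
        then show ?thesis
          using power5[of "3 / 2"] by (intro le_quarter[of 1]) (auto simp: power_divide)
      next
        case 3
        then show ?thesis
          using power5[of 2] by (intro le_quarter[of "3 / 2"]) auto
      next
        case 4
        have "T ^ 7 \<le> (5 / 2) ^ 7" using T 4 by (intro power_mono) auto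
        then show ?thesis
          using 4 \<tau>_power[of 7] by (intro le_quarter[of 2]) (auto simp: power_divide fact_numeral)
      next
        case 5
        have "T ^ 7 \<le> 3 ^ 7" using T 5 by (intro power_mono) auto
        then show ?thesis
          using 5 \<tau>_power[of 7] by (intro le_quarter[of "5 / 2"]) (auto simp: fact_numeral)
      next
        case 6
        then have "n \<in> {3, 4, 5, 6}" using n by auto
        then have "\<tau> \<le> 3 / 16"
          using \<tau>_binomial 6(2) by (elim insertE) (auto simp: binomial_fact fact_numeral power_divide binomial_eq_0)
        then show ?thesis using 6 by (intro le_quarter[of 2]) auto
      next
        case 7
        \<comment> \<open>Only \<open>1 / 6 \<le> \<gamma>\<close> is obtained here, so the second
          alternative is proved instead: \<open>7 / 72\<close> is
          \<open>7 / 2 * (1 / 6) ^ 2\<close>, and \<open>h < 5\<close> keeps \<kappa> below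
          it.\<close>
        have "h < 5" using m(3) 7 by (simp add: M_def)
        then have "2 / 5 \<le> 2 / h" using h by (intro divide_left_mono) auto
        then have "max 0 (1 - 2 / h) \<le> 3 / 5"
          by (intro max.boundedI) linarith+
        then have "\<kappa> \<le> (3 / 5) ^ (n - 1)"
          unfolding \<kappa>_def by (intro power_mono) simp_all
        also have "\<dots> \<le> (3 / 5 :: real) ^ 6"
          using 7 by (intro power_decreasing) auto
        finally have "\<kappa> \<le> 7 / 72" by (simp add: power_divide)
        moreover have "1 / 6 \<le> \<gamma>"
          using T_ge[of 2] 7 \<tau>_half bound by simp
        moreover from this have "(1 / 6)\<^sup>2 \<le> \<gamma>\<^sup>2" by (intro power_mono) auto
        ultimately show ?thesis by (simp add: power2_eq_square)
      next
        case 8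
        then show ?thesis using \<tau>_half by (intro le_quarter[of 3]) auto
      qed
    qed
  qed
qed

section \<open>The uniform measure on the torus\<close>

lemma torus_of_real_surj: "\<exists>t. 0 \<le> t \<and> t < 1 \<and> x = torus_of_real t"
proof -
  have "torus_of_real (torus_rep x) = x"
    using Quotient_torus unfolding Quotient_def by blast
  moreover have "torus_of_real (torus_rep x) = torus_of_real (frac (torus_rep x))"
    by (simp add: torus.abs_eq_iff frac_def)
  ultimately show ?thesis
    by (metis frac_ge_0 frac_lt_1)
qed

text \<open>Second countability makes \<open>dist\<close> measurable on the product of the Borel \<open>\<sigma>\<close>-algebras.\<close>

instance torus :: second_countable_topology
proof
  define B where "B = (\<lambda>(q, r). ball (torus_of_real q) r) ` (\<rat> \<times> \<rat>)"
  have "topological_basis B"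
  proof (rule topological_basisI)
    fix U :: "torus set" and x
    assume "open U" "x \<in> U"
    then obtain e where e: "e > 0" "ball x e \<subseteq> U"
      by (rule openE)
    obtain t where t: "x = torus_of_real t"
      using torus_of_real_surj by blast
    obtain r where r: "r \<in> \<rat>" "0 < r" "r < e / 2"
      using Rats_dense_in_real[of 0 "e / 2"] e by auto
    obtain q where q: "q \<in> \<rat>" "t < q" "q < t + r"
      using Rats_dense_in_real[of t "t + r"] r by auto
    have d: "dist (torus_of_real q) x < r"
      using infdist_le[OF Ints_0, of "q - t"] q by (simp add: t dist_torus_of_real)
    have "ball (torus_of_real q) r \<subseteq> ball x e"
    proof
      fix y assume "y \<in> ball (torus_of_real q) r"
      then show "y \<in> ball x e"
        using d r dist_triangle[of x y "torus_of_real q"] by (simp add: dist_commute)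
    qed
    with e d q r show "\<exists>V\<in>B. x \<in> V \<and> V \<subseteq> U"
      unfolding B_def by (intro bexI[of _ "ball (torus_of_real q) r"]) auto
  qed (auto simp: B_def)
  moreover have "countable B"
    by (simp add: B_def countable_rat)
  ultimately show "\<exists>B :: torus set set. countable B \<and> open = generate_topology B"
    using topological_basis_imp_subbasis by blast
qed

lemma sets_torus_uniform [simp, measurable_cong]: "sets torus_uniform = sets borel"
  by (simp add: torus_uniform_def)

lemma space_torus_uniform [simp]: "space torus_uniform = UNIV"
  by (simp add: torus_uniform_def)

text \<open>For \<open>r \<le> 1 / 2\<close> the set is an arc of length \<open>1 - 2 * r\<close>.
  Cutting the circle at the class of \<open>0\<close> splits it into at most two intervals of
  representatives, on either side of \<open>t\<close>.\<close>

lemma emeasure_torus_uniform_dist_ge: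
  assumes "0 \<le> r"
  shows "emeasure torus_uniform {y. r \<le> dist x y} \<le> ennreal (max 0 (1 - 2 * r))"
proof -
  obtain t where t: "0 \<le> t" "t < 1" "x = torus_of_real t"
    using torus_of_real_surj by blast
  let ?S = "{u \<in> {0..<1}. r \<le> dist x (torus_of_real u)}"
  have S: "?S \<in> sets lborel" by measurable
  have "?S \<subseteq> {max 0 (t - 1 + r)..t - r} \<union> {t + r..min 1 (t + 1 - r)}"
  proof
    fix u assume u: "u \<in> ?S"
    then have "dist x (torus_of_real u) = min \<bar>t - u\<bar> (1 - \<bar>t - u\<bar>)"
      unfolding t(3) using t by (intro dist_torus_of_real_unit) auto
    with u show "u \<in> {max 0 (t - 1 + r)..t - r} \<union> {t + r..min 1 (t + 1 - r)}"
      by (auto simp: abs_if split: if_splits)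
  qed
  then have "emeasure lborel ?S \<le> emeasure lborel ({max 0 (t - 1 + r)..t - r} \<union> {t + r..min 1 (t + 1 - r)})"
    by (intro emeasure_mono) auto
  also have "\<dots> \<le> emeasure lborel {max 0 (t - 1 + r)..t - r} + emeasure lborel {t + r..min 1 (t + 1 - r)}"
    by (intro emeasure_subadditive) auto
  also have "\<dots> = ennreal (max 0 (t - r - max 0 (t - 1 + r))) + ennreal (max 0 (min 1 (t + 1 - r) - (t + r)))"
    by (auto simp: emeasure_lborel_Icc_eq max_def ennreal_neg)
  also have "\<dots> = ennreal (max 0 (t - r - max 0 (t - 1 + r)) + max 0 (min 1 (t + 1 - r) - (t + r)))"
    by (simp add: ennreal_plus)
  also have "\<dots> \<le> ennreal (max 0 (1 - 2 * r))"
    using t assms by (intro ennreal_leI) (auto simp: max_def min_def)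
  finally have "emeasure lborel ?S \<le> ennreal (max 0 (1 - 2 * r))" .
  moreover have "emeasure torus_uniform {y. r \<le> dist x y} = emeasure lborel ?S"
  proof -
    have "emeasure torus_uniform {y. r \<le> dist x y} =
        emeasure (uniform_measure lborel {0..<1}) {u. r \<le> dist x (torus_of_real u)}"
      unfolding torus_uniform_def by (subst emeasure_distr) (auto simp: vimage_def)
    also have "\<dots> = emeasure lborel ?S"
      by (subst emeasure_uniform_measure)
        (auto simp: divide_ennreal_def intro!: arg_cong[of _ _ "emeasure lborel"])
    finally show ?thesis .
  qed
  ultimately show ?thesis by simp
qed

section \<open>Leave-one-out errors of Shepard's model\<close>

lemma dist_torus_le_1: "dist x y \<le> (1::real)" for x y :: torus
proof -
  obtain s t where s: "0 \<le> s" "s < 1" "x = torus_of_real s"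
    and t: "0 \<le> t" "t < 1" "y = torus_of_real t"
    using torus_of_real_surj[of x] torus_of_real_surj[of y] by blast
  have "dist x y = min \<bar>s - t\<bar> (1 - \<bar>s - t\<bar>)"
    unfolding s(3) t(3) by (rule dist_torus_of_real_unit) (use s t in linarith)
  then show ?thesis using s t by linarith
qed

text \<open>A Lipschitz function on a space of finite diameter is bounded, which makes the
  real-valued \<open>SUP\<close> in \<open>sup_norm\<close> a genuine supremum.\<close>

lemma abs_le_sup_norm:
  assumes "L-lipschitz_on UNIV f"
  shows "\<bar>f x\<bar> \<le> sup_norm f"
  unfolding sup_norm_def
proof (rule cSUP_upper)
  have "L \<ge> 0" using assms by (rule lipschitz_on_nonneg)
  have "\<bar>f y\<bar> \<le> \<bar>f x\<bar> + L" for y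
  proof -
    have "dist (f y) (f x) \<le> L * dist y x"
      using assms by (rule lipschitz_onD) auto
    also have "\<dots> \<le> L * 1"
      using \<open>L \<ge> 0\<close> dist_torus_le_1 by (intro mult_left_mono)
    finally show ?thesis by (simp add: dist_real_def)
  qed
  then show "bdd_above (range (\<lambda>x. \<bar>f x\<bar>))" by (rule bdd_aboveI2)
qed simp

lemma kernel_profileD:
  assumes "kernel_profile h k" and "0 \<le> t"
  shows "0 \<le> k t" and "k t \<noteq> 0 \<Longrightarrow> t \<le> 1 / h" and "t < 1 / h \<Longrightarrow> 0 < k t"
proof -
  show "0 \<le> k t" "t < 1 / h \<Longrightarrow> 0 < k t"
    using assms by (auto simp: kernel_profile_def)
  assume "k t \<noteq> 0"
  then have "t \<in> {t. 0 \<le> t \<and> k t \<noteq> 0}"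
    using assms(2) by simp
  also have "\<dots> \<subseteq> closure {t. 0 \<le> t \<and> k t \<noteq> 0}"
    by (rule closure_subset)
  also have "\<dots> = {0..1 / h}"
    using assms(1) unfolding kernel_profile_def by blast
  finally show "t \<le> 1 / h"
    by (simp only: atLeastAtMost_iff)
qed

text \<open>The profile is measurable only on the nonnegative reals. Its extension by zero is
  measurable everywhere and agrees with it at distances.\<close>

lemma borel_measurable_kernel_dist:
  fixes g g' :: "'a \<Rightarrow> torus"
  assumes "kernel_profile h k" and [measurable]: "g \<in> borel_measurable M" "g' \<in> borel_measurable M"
  shows "(\<lambda>\<omega>. k (dist (g \<omega>) (g' \<omega>))) \<in> borel_measurable M"
proof -
  have [measurable]: "(\<lambda>t. indicator {0..} t *\<^sub>R k t) \<in> borel_measurable borel"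
    using assms(1) by (simp add: kernel_profile_def set_borel_measurable_def)
  have "(\<lambda>\<omega>. indicator {0..} (dist (g \<omega>) (g' \<omega>)) *\<^sub>R k (dist (g \<omega>) (g' \<omega>))) \<in> borel_measurable M"
    by measurable
  then show ?thesis by simp
qed

lemma abs_weighted_average_diff_le:
  fixes w v :: "'i \<Rightarrow> real"
  assumes "\<And>j. j \<in> J \<Longrightarrow> 0 \<le> w j" and "\<And>j. j \<in> J \<Longrightarrow> w j \<noteq> 0 \<Longrightarrow> \<bar>v j - c\<bar> \<le> e"
    and "0 < sum w J"
  shows "\<bar>(\<Sum>j\<in>J. w j * v j) / sum w J - c\<bar> \<le> e"
proof -
  have "(\<Sum>j\<in>J. w j * v j) / sum w J - c = (\<Sum>j\<in>J. w j * (v j - c)) / sum w J"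
    using assms(3) by (simp add: right_diff_distrib sum_subtractf sum_distrib_right[symmetric] diff_divide_distrib)
  also have "\<bar>\<dots>\<bar> = \<bar>\<Sum>j\<in>J. w j * (v j - c)\<bar> / sum w J"
    using assms(3) by simp
  also have "\<dots> \<le> (\<Sum>j\<in>J. w j * e) / sum w J"
  proof (rule divide_right_mono)
    have "\<bar>\<Sum>j\<in>J. w j * (v j - c)\<bar> \<le> (\<Sum>j\<in>J. \<bar>w j * (v j - c)\<bar>)" by (rule sum_abs)
    also have "\<dots> \<le> (\<Sum>j\<in>J. w j * e)"
    proof (rule sum_mono)
      fix j assume "j \<in> J"
      then show "\<bar>w j * (v j - c)\<bar> \<le> w j * e"
        using assms(1,2)[of j] by (cases "w j = 0") (auto simp: abs_mult intro!: mult_left_mono)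
    qed
    finally show "\<bar>\<Sum>j\<in>J. w j * (v j - c)\<bar> \<le> (\<Sum>j\<in>J. w j * e)" .
  qed (use assms(3) in simp)
  also have "\<dots> = e"
    using assms(3) by (simp add: sum_distrib_right[symmetric])
  finally show ?thesis .
qed

lemma shepard_leave_out_sample_list:
  assumes "i < n"
  shows "shepard k (leave_out i (sample_list f n y)) x =
    (\<Sum>j\<in>{..<n} - {i}. k (dist x (y j)) * f (y j)) / (\<Sum>j\<in>{..<n} - {i}. k (dist x (y j)))"
proof -
  define js where "js = [0..<i] @ [Suc i..<n]"
  have "leave_out i (sample_list f n y) = map (\<lambda>j. (y j, f (y j))) js"
    using assms by (simp add: leave_out_def sample_list_def js_def take_map drop_map)
  moreover have "distinct js" "set js = {..<n} - {i}"
    using assms by (auto simp: js_def)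
  ultimately show ?thesis
    by (simp add: shepard_def o_def sum_list_distinct_conv_sum_set)
qed

text \<open>The alternatives arise from a nonzero and a zero denominator, but they can overlap: the
  kernel may be positive at distance exactly \<open>1 / h\<close>, so a sample there can contribute
  although it does not count as close.\<close>

lemma shepard_leave_out_error:
  fixes y :: "nat \<Rightarrow> torus" and x :: torus
  assumes kernel: "kernel_profile h k" and h: "0 < h" and lip: "L-lipschitz_on UNIV f" and i: "i < n"
  defines "e \<equiv> \<bar>shepard k (leave_out i (sample_list f n y)) x - f x\<bar>"
  shows "e \<le> L / h \<or> e \<le> sup_norm f \<and> (\<forall>j\<in>{..<n} - {i}. 1 / h \<le> dist x (y j))"
proof (cases "(\<Sum>j\<in>{..<n} - {i}. k (dist x (y j))) = 0")
  case True
  then have "k (dist x (y j)) = 0" if "j \<in> {..<n} - {i}" for j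
    using that kernel_profileD(1)[OF kernel] by (subst (asm) sum_nonneg_eq_0_iff) auto
  then have "\<forall>j\<in>{..<n} - {i}. 1 / h \<le> dist x (y j)"
    using kernel_profileD(3)[OF kernel zero_le_dist] by (metis less_irrefl not_le)
  \<comment> \<open>By the convention on division by zero the model takes the value \<open>0\<close>
    here.\<close>
  moreover have "e = \<bar>f x\<bar>"
    using True i by (simp add: e_def shepard_leave_out_sample_list)
  ultimately show ?thesis using abs_le_sup_norm[OF lip] by simp
next
  case False
  have "e \<le> L / h"
    unfolding e_def shepard_leave_out_sample_list[OF i]
  proof (rule abs_weighted_average_diff_le)
    show "0 \<le> k (dist x (y j))" for j
      using kernel_profileD(1)[OF kernel] by simp
    then show "0 < (\<Sum>j\<in>{..<n} - {i}. k (dist x (y j)))"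
      using False by (metis less_eq_real_def sum_nonneg)
    fix j assume "k (dist x (y j)) \<noteq> 0"
    then have "dist x (y j) \<le> 1 / h"
      using kernel_profileD(2)[OF kernel] by simp
    then have "L * dist x (y j) \<le> L * (1 / h)"
      using lipschitz_on_nonneg[OF lip] by (intro mult_left_mono)
    moreover have "dist (f x) (f (y j)) \<le> L * dist x (y j)"
      using lip by (rule lipschitz_onD) auto
    ultimately show "\<bar>f (y j) - f x\<bar> \<le> L / h"
      by (simp add: dist_real_def abs_minus_commute)
  qed
  then show ?thesis ..
qed

section \<open>Random samples: errors, score and risk\<close>

locale shepard_samples = prob_space M for M :: "'a measure" +
  fixes X :: "nat \<Rightarrow> 'a \<Rightarrow> torus" and f :: "torus \<Rightarrow> real" and k :: "real \<Rightarrow> real"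
    and n :: nat and h L :: real
  assumes n: "2 \<le> n" and h: "0 < h" and lip: "L-lipschitz_on UNIV f"
    and kernel: "kernel_profile h k"
    and indep: "indep_vars (\<lambda>_. borel) X {..<n}"
    and uniform: "i < n \<Longrightarrow> distr M borel (X i) = torus_uniform"
begin

lemma n_pos: "0 < n"
  using n by simp

text \<open>The point \<open>x\<close> is left free so that the same error serves the score, at
  \<open>x = X i \<omega>\<close>, and the risk, with \<open>i = 0\<close> and \<open>x\<close>
  integrated over the torus.\<close>

definition loo_error :: "nat \<Rightarrow> 'a \<Rightarrow> torus \<Rightarrow> real" where
  "loo_error i \<omega> x = \<bar>shepard k (leave_out i (sample_list f n (\<lambda>i. X i \<omega>))) x - f x\<bar>"

definition uncovered :: "nat \<Rightarrow> 'a \<Rightarrow> torus \<Rightarrow> bool" where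
  "uncovered i \<omega> x \<longleftrightarrow> (\<forall>j\<in>{..<n} - {i}. 1 / h \<le> dist x (X j \<omega>))"

definition deviation :: "'a \<Rightarrow> real" where
  "deviation \<omega> = \<bar>cv_score k (sample_list f n (\<lambda>i. X i \<omega>))
     - risk f (shepard k (leave_out 0 (sample_list f n (\<lambda>i. X i \<omega>))))\<bar>"

text \<open>The sum of the two shares dominates each of them and, unlike their maximum, has an
  expectation that splits by linearity.\<close>

definition uncovered_fraction :: "'a \<Rightarrow> real" where
  "uncovered_fraction \<omega> = (\<Sum>i<n. of_bool (uncovered i \<omega> (X i \<omega>))) / real n
     + (LINT x|torus_uniform. of_bool (uncovered 0 \<omega> x))"

definition \<kappa> :: real where
  "\<kappa> = (max 0 (1 - 2 / h)) ^ (n - 1)"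

sublocale T: prob_space torus_uniform
  by (rule prob_space_torus_uniform)

sublocale MT: pair_prob_space M torus_uniform ..

lemma loo_error_bounds:
  assumes "i < n"
  shows "0 \<le> (loo_error i \<omega> x)\<^sup>2"
    and "(loo_error i \<omega> x)\<^sup>2 \<le> max (L\<^sup>2 / h\<^sup>2) ((sup_norm f)\<^sup>2)"
    and "(loo_error i \<omega> x)\<^sup>2 \<le> L\<^sup>2 / h\<^sup>2 + (sup_norm f)\<^sup>2 * of_bool (uncovered i \<omega> x)"
proof -
  have nonneg: "0 \<le> loo_error i \<omega> x" by (simp add: loo_error_def)
  consider "loo_error i \<omega> x \<le> L / h" | "loo_error i \<omega> x \<le> sup_norm f" "uncovered i \<omega> x"
    using shepard_leave_out_error[OF kernel h lip assms, of "\<lambda>i. X i \<omega>" x]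
    unfolding loo_error_def uncovered_def by blast
  then have sq: "(loo_error i \<omega> x)\<^sup>2 \<le> L\<^sup>2 / h\<^sup>2 \<or>
      (loo_error i \<omega> x)\<^sup>2 \<le> (sup_norm f)\<^sup>2 \<and> uncovered i \<omega> x"
  proof cases
    case 1
    then have "(loo_error i \<omega> x)\<^sup>2 \<le> (L / h)\<^sup>2" by (rule power_mono[OF _ nonneg])
    then show ?thesis unfolding power_divide ..
  next
    case 2
    then have "(loo_error i \<omega> x)\<^sup>2 \<le> (sup_norm f)\<^sup>2" by (intro power_mono[OF _ nonneg])
    then show ?thesis using 2 by simp
  qed
  then show "(loo_error i \<omega> x)\<^sup>2 \<le> max (L\<^sup>2 / h\<^sup>2) ((sup_norm f)\<^sup>2)"
    unfolding le_max_iff_disj by blast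
  have "0 \<le> L\<^sup>2 / h\<^sup>2" "0 \<le> (sup_norm f)\<^sup>2" by simp_all
  with sq show "(loo_error i \<omega> x)\<^sup>2 \<le> L\<^sup>2 / h\<^sup>2 + (sup_norm f)\<^sup>2 * of_bool (uncovered i \<omega> x)"
    by (cases "uncovered i \<omega> x") (simp_all only: of_bool_eq mult_1_right mult_zero_right simp_thms, linarith+)
qed simp

lemma measurable_X [measurable]: "i < n \<Longrightarrow> X i \<in> borel_measurable M"
  using indep by (auto simp: indep_vars_def)

lemma measurable_f [measurable]: "f \<in> borel_measurable borel"
  using lipschitz_on_continuous_on[OF lip] by (rule borel_measurable_continuous_onI)

text \<open>The composition with \<open>g\<close> and \<open>g'\<close> covers both the evaluation
  at a sample, on \<open>M\<close>, and the joint measurability on the product with the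
  torus.\<close>

lemma measurable_loo_error:
  assumes "i < n" and [measurable]: "g \<in> N \<rightarrow>\<^sub>M M" "g' \<in> borel_measurable N"
  shows "(\<lambda>z. loo_error i (g z) (g' z)) \<in> borel_measurable N"
proof -
  have [measurable]: "(\<lambda>z. X j (g z)) \<in> borel_measurable N" if "j < n" for j
    using assms(2) measurable_X[OF that] by (rule measurable_compose)
  then have [measurable]: "(\<lambda>z. k (dist (g' z) (X j (g z)))) \<in> borel_measurable N" if "j < n" for j
    using that by (intro borel_measurable_kernel_dist[OF kernel]) auto
  show ?thesis
    unfolding loo_error_def shepard_leave_out_sample_list[OF assms(1)] by measurable
qed

lemma measurable_uncovered:
  assumes [measurable]: "g \<in> N \<rightarrow>\<^sub>M M" "g' \<in> borel_measurable N"
  shows "Measurable.pred N (\<lambda>z. uncovered i (g z) (g' z))"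
proof -
  have "Measurable.pred N (\<lambda>z. 1 / h \<le> dist (g' z) (X j (g z)))" if "j < n" for j
  proof -
    have [measurable]: "(\<lambda>z. X j (g z)) \<in> borel_measurable N"
      using assms(1) measurable_X[OF that] by (rule measurable_compose)
    show ?thesis by measurable
  qed
  then show ?thesis
    unfolding uncovered_def by (intro pred_intros_finite) auto
qed

lemma cv_score_eq:
  "cv_score k (sample_list f n (\<lambda>i. X i \<omega>)) = (\<Sum>i<n. (loo_error i \<omega> (X i \<omega>))\<^sup>2) / real n"
proof -
  let ?z = "sample_list f n (\<lambda>i. X i \<omega>)"
  have nth: "?z ! i = (X i \<omega>, f (X i \<omega>))" if "i < n" for i
    using that by (simp add: sample_list_def)
  have length: "length ?z = n" by (simp add: sample_list_def)
  have "(\<Sum>i<n. \<bar>shepard k (leave_out i ?z) (fst (?z ! i)) - snd (?z ! i)\<bar>\<^sup>2) =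
      (\<Sum>i<n. (loo_error i \<omega> (X i \<omega>))\<^sup>2)"
    by (intro sum.cong refl) (simp only: lessThan_iff nth loo_error_def fst_conv snd_conv)
  then show ?thesis
    unfolding cv_score_def length by (simp only: times_divide_eq_left mult_1)
qed

lemma risk_eq:
  "risk f (shepard k (leave_out 0 (sample_list f n (\<lambda>i. X i \<omega>)))) =
     (LINT x|torus_uniform. (loo_error 0 \<omega> x)\<^sup>2)"
  by (simp only: risk_def loo_error_def)

lemma measurable_deviation [measurable]: "deviation \<in> borel_measurable M"
proof -
  have "(\<lambda>z. loo_error 0 (fst z) (snd z)) \<in> borel_measurable (M \<Otimes>\<^sub>M torus_uniform)"
    by (intro measurable_loo_error n_pos) measurable
  then have [measurable]: "(\<lambda>\<omega>. LINT x|torus_uniform. (loo_error 0 \<omega> x)\<^sup>2) \<in> borel_measurable M"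
    by (intro T.borel_measurable_lebesgue_integral) (simp add: split_beta')
  have "(\<lambda>\<omega>. loo_error i \<omega> (X i \<omega>)) \<in> borel_measurable M" if "i < n" for i
    using that by (intro measurable_loo_error) auto
  then have [measurable]: "(\<lambda>\<omega>. (\<Sum>i<n. (loo_error i \<omega> (X i \<omega>))\<^sup>2)) \<in> borel_measurable M"
    by (intro borel_measurable_sum borel_measurable_power) auto
  show ?thesis
    unfolding deviation_def[abs_def] cv_score_eq risk_eq by measurable
qed

lemma integrable_loo_error:
  assumes "\<omega> \<in> space M"
  shows "integrable torus_uniform (\<lambda>x. (loo_error 0 \<omega> x)\<^sup>2)"
proof (rule T.integrable_const_bound)
  show "AE x in torus_uniform. norm ((loo_error 0 \<omega> x)\<^sup>2) \<le> max (L\<^sup>2 / h\<^sup>2) ((sup_norm f)\<^sup>2)"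
    by (simp only: real_norm_def abs_of_nonneg[OF zero_le_power2] loo_error_bounds(2)[OF n_pos] AE_I2)
  show "(\<lambda>x. (loo_error 0 \<omega> x)\<^sup>2) \<in> borel_measurable torus_uniform"
    using assms by (intro borel_measurable_power measurable_loo_error n_pos) auto
qed

lemma integrable_uncovered:
  assumes "\<omega> \<in> space M"
  shows "integrable torus_uniform (\<lambda>x. of_bool (uncovered 0 \<omega> x) :: real)"
proof (rule T.integrable_const_bound[of _ 1])
  show "(\<lambda>x. of_bool (uncovered 0 \<omega> x) :: real) \<in> borel_measurable torus_uniform"
    using assms by (intro measurable_compose[OF measurable_uncovered measurable_of_bool]) auto
qed (rule AE_I2, simp)

text \<open>Score and risk lie in the same interval from \<open>0\<close> to the bound, so their
  difference costs no factor \<open>2\<close>.\<close>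

lemma deviation_le_max:
  assumes "\<omega> \<in> space M"
  shows "deviation \<omega> \<le> max (L\<^sup>2 / h\<^sup>2) ((sup_norm f)\<^sup>2)" (is "_ \<le> ?c")
proof -
  have "(\<Sum>i<n. (loo_error i \<omega> (X i \<omega>))\<^sup>2) \<le> (\<Sum>i<n. ?c)"
    by (intro sum_mono loo_error_bounds(2)) simp
  then have "(\<Sum>i<n. (loo_error i \<omega> (X i \<omega>))\<^sup>2) / real n \<le> ?c"
    using n by (simp add: field_simps)
  moreover have "0 \<le> (\<Sum>i<n. (loo_error i \<omega> (X i \<omega>))\<^sup>2) / real n"
    by (intro divide_nonneg_nonneg sum_nonneg) auto
  moreover have "(LINT x|torus_uniform. (loo_error 0 \<omega> x)\<^sup>2) \<le> ?c"
    by (intro T.integral_le_const integrable_loo_error assms AE_I2 loo_error_bounds(2) n_pos)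
  moreover have "0 \<le> (LINT x|torus_uniform. (loo_error 0 \<omega> x)\<^sup>2)"
    by (intro integral_nonneg_AE) auto
  ultimately show ?thesis
    unfolding deviation_def cv_score_eq risk_eq by linarith
qed

lemma uncovered_fraction_nonneg: "0 \<le> uncovered_fraction \<omega>"
  unfolding uncovered_fraction_def
  by (rule add_nonneg_nonneg[OF divide_nonneg_nonneg[OF sum_nonneg] Bochner_Integration.integral_nonneg]) simp_all

text \<open>Score and risk are nonnegative, so their difference is at most the larger of the two;
  averaging the pointwise error bound controls each by its own share of uncovered points.\<close>

lemma deviation_le_uncovered_fraction:
  assumes "\<omega> \<in> space M"
  shows "deviation \<omega> \<le> L\<^sup>2 / h\<^sup>2 + (sup_norm f)\<^sup>2 * uncovered_fraction \<omega>"
proof -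
  let ?s = "L\<^sup>2 / h\<^sup>2" and ?B = "(sup_norm f)\<^sup>2"
  define G where "G = (\<Sum>i<n. of_bool (uncovered i \<omega> (X i \<omega>)) :: real)"
  define A where "A = G / real n"
  define U where "U = (LINT x|torus_uniform. of_bool (uncovered 0 \<omega> x) :: real)"
  have fraction: "uncovered_fraction \<omega> = A + U"
    by (simp only: uncovered_fraction_def A_def G_def U_def)
  have "(\<Sum>i<n. (loo_error i \<omega> (X i \<omega>))\<^sup>2) \<le> (\<Sum>i<n. ?s + ?B * of_bool (uncovered i \<omega> (X i \<omega>)))"
    by (rule sum_mono) (rule loo_error_bounds(3), simp)
  also have "\<dots> = real n * ?s + ?B * G"
    by (simp only: G_def sum.distrib sum_constant card_lessThan sum_distrib_left)
  finally have "(\<Sum>i<n. (loo_error i \<omega> (X i \<omega>))\<^sup>2) / real n \<le> (real n * ?s + ?B * G) / real n"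
    by (rule divide_right_mono) simp
  also have "\<dots> = ?s + ?B * A"
    using n_pos by (simp add: A_def add_divide_distrib)
  finally have "(\<Sum>i<n. (loo_error i \<omega> (X i \<omega>))\<^sup>2) / real n \<le> ?s + ?B * A" .
  moreover have "0 \<le> (\<Sum>i<n. (loo_error i \<omega> (X i \<omega>))\<^sup>2) / real n"
    by (intro divide_nonneg_nonneg sum_nonneg) auto
  moreover have "(LINT x|torus_uniform. (loo_error 0 \<omega> x)\<^sup>2) \<le> ?s + ?B * U"
  proof -
    have "(LINT x|torus_uniform. (loo_error 0 \<omega> x)\<^sup>2) \<le>
        (LINT x|torus_uniform. ?s + ?B * of_bool (uncovered 0 \<omega> x))"
      by (intro integral_mono integrable_loo_error assms loo_error_bounds(3) n_pos
          Bochner_Integration.integrable_add integrable_mult_right integrable_uncovered T.integrable_const)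
    also have "\<dots> = ?s + ?B * U"
      using integrable_uncovered[OF assms] by (simp add: U_def T.prob_space[simplified])
    finally show ?thesis .
  qed
  moreover have "0 \<le> (LINT x|torus_uniform. (loo_error 0 \<omega> x)\<^sup>2)"
    by (intro integral_nonneg_AE) auto
  moreover have "0 \<le> A"
    unfolding A_def G_def by (rule divide_nonneg_nonneg[OF sum_nonneg]) simp_all
  then have "?B * U \<le> ?B * uncovered_fraction \<omega>"
    unfolding fraction by (intro mult_left_mono) simp_all
  moreover have "0 \<le> U"
    unfolding U_def by (rule Bochner_Integration.integral_nonneg) simp
  then have "?B * A \<le> ?B * uncovered_fraction \<omega>"
    unfolding fraction by (intro mult_left_mono) simp_all
  ultimately show ?thesis
    unfolding deviation_def cv_score_eq risk_eq by linarith
qed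

section \<open>Probability that a point or a sample is uncovered\<close>

lemma product_sigma_finite_torus: "product_sigma_finite (\<lambda>_::nat. torus_uniform)"
  by unfold_locales

lemma emeasure_PiM_uncovered:
  assumes "i < n"
  shows "emeasure (PiM ({..<n} - {i}) (\<lambda>_. torus_uniform)) (PiE ({..<n} - {i}) (\<lambda>_. {y. 1 / h \<le> dist x y}))
    \<le> ennreal \<kappa>"
proof -
  interpret product_sigma_finite "\<lambda>_::nat. torus_uniform" by (rule product_sigma_finite_torus)
  have "emeasure (PiM ({..<n} - {i}) (\<lambda>_. torus_uniform)) (PiE ({..<n} - {i}) (\<lambda>_. {y. 1 / h \<le> dist x y}))
      = (\<Prod>j\<in>{..<n} - {i}. emeasure torus_uniform {y. 1 / h \<le> dist x y})"
    by (intro emeasure_PiM) auto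
  also have "\<dots> \<le> (\<Prod>j\<in>{..<n} - {i}. ennreal (max 0 (1 - 2 / h)))"
    using emeasure_torus_uniform_dist_ge[of "1 / h" x] h by (intro prod_mono_ennreal) auto
  also have "\<dots> = ennreal (max 0 (1 - 2 / h)) ^ (n - 1)"
    using assms by simp
  also have "\<dots> = ennreal \<kappa>"
    unfolding \<kappa>_def by (rule ennreal_power) simp
  finally show ?thesis .
qed

lemma distr_samples:
  assumes "J \<subseteq> {..<n}" and "J \<noteq> {}"
  shows "distr M (PiM J (\<lambda>_. borel)) (\<lambda>\<omega>. \<lambda>i\<in>J. X i \<omega>) = PiM J (\<lambda>_. torus_uniform)"
proof -
  have "X i \<in> borel_measurable M" if "i \<in> J" for i
    using that assms(1) by auto
  from indep_vars_iff_distr_eq_PiM'[OF assms(2) this, THEN iffD1, OF _ indep_vars_subset[OF indep assms(1)]]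
  have "distr M (PiM J (\<lambda>_. borel)) (\<lambda>\<omega>. \<lambda>i\<in>J. X i \<omega>) = PiM J (\<lambda>i. distr M borel (X i))"
    by simp
  also have "\<dots> = PiM J (\<lambda>_. torus_uniform)"
    using assms(1) uniform by (intro PiM_cong) auto
  finally show ?thesis .
qed

lemma prob_uncovered_point:
  assumes "i < n"
  shows "prob {\<omega> \<in> space M. uncovered i \<omega> x} \<le> \<kappa>"
proof -
  let ?J = "{..<n} - {i}"
  \<comment> \<open>The description of the joint law by a product measure needs a nonempty index
    set; \<open>2 \<le> n\<close> leaves an index other than \<open>i\<close>.\<close>
  have "(if i = 0 then 1 else 0) \<in> ?J"
    using n by auto
  then have J: "?J \<noteq> {}" by blast
  let ?A = "PiE ?J (\<lambda>_. {y. 1 / h \<le> dist x y})"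
  have A: "?A \<in> sets (PiM ?J (\<lambda>_. borel))"
    by (intro sets_PiM_I_finite) auto
  have "emeasure M {\<omega> \<in> space M. uncovered i \<omega> x} =
      emeasure (distr M (PiM ?J (\<lambda>_. borel)) (\<lambda>\<omega>. \<lambda>i\<in>?J. X i \<omega>)) ?A"
  proof (subst emeasure_distr[OF _ A])
    show "(\<lambda>\<omega>. \<lambda>i\<in>?J. X i \<omega>) \<in> M \<rightarrow>\<^sub>M PiM ?J (\<lambda>_. borel)"
      by (intro measurable_restrict measurable_X) simp
    have "(\<lambda>i\<in>?J. X i \<omega>) \<in> ?A \<longleftrightarrow> uncovered i \<omega> x" for \<omega>
      unfolding PiE_iff uncovered_def
      by (simp only: restrict_extensional restrict_apply' mem_Collect_eq simp_thms cong: ball_cong)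
    then have "{\<omega> \<in> space M. uncovered i \<omega> x} = (\<lambda>\<omega>. \<lambda>i\<in>?J. X i \<omega>) -` ?A \<inter> space M"
      by blast
    then show "emeasure M {\<omega> \<in> space M. uncovered i \<omega> x} =
        emeasure M ((\<lambda>\<omega>. \<lambda>i\<in>?J. X i \<omega>) -` ?A \<inter> space M)"
      by (rule arg_cong)
  qed
  also have "\<dots> \<le> ennreal \<kappa>"
    unfolding distr_samples[OF Diff_subset J] by (rule emeasure_PiM_uncovered[OF assms])
  finally show ?thesis
    by (simp add: emeasure_eq_measure \<kappa>_def)
qed

text \<open>Given the position of \<open>X i\<close>, the other samples are still independent and
  uniform. So coordinate \<open>i\<close> is split off the product measure, and the bound for a
  fixed point applies to the inner integral.\<close>

lemma prob_uncovered_sample: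
  assumes "i < n"
  shows "prob {\<omega> \<in> space M. uncovered i \<omega> (X i \<omega>)} \<le> \<kappa>"
proof -
  let ?J = "{..<n} - {i}"
  interpret P: product_sigma_finite "\<lambda>_::nat. torus_uniform" by (rule product_sigma_finite_torus)
  have I: "insert i ?J = {..<n}" using assms by auto
  let ?A = "{y \<in> space (PiM {..<n} (\<lambda>_. borel :: torus measure)). \<forall>j\<in>?J. 1 / h \<le> dist (y i) (y j)}"
  have A: "?A \<in> sets (PiM {..<n} (\<lambda>_. borel))"
  proof (intro predE pred_intros_finite)
    fix j assume "j \<in> ?J"
    have "(\<lambda>y. y l) \<in> PiM {..<n} (\<lambda>_. borel :: torus measure) \<rightarrow>\<^sub>M borel" if "l < n" for l
      using that by (intro measurable_component_singleton) simp
    with \<open>j \<in> ?J\<close> assms have "(\<lambda>y. dist (y i) (y j)) \<in> borel_measurable (PiM {..<n} (\<lambda>_. borel :: torus measure))"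
      by (intro borel_measurable_dist) auto
    then show "Measurable.pred (PiM {..<n} (\<lambda>_. borel :: torus measure)) (\<lambda>y. 1 / h \<le> dist (y i) (y j))"
      unfolding pred_def by (intro borel_measurable_le borel_measurable_const)
  qed simp
  have sets_eq: "sets (PiM {..<n} (\<lambda>_. torus_uniform)) = sets (PiM {..<n} (\<lambda>_. borel))"
    by (intro sets_PiM_cong) auto
  have "emeasure M {\<omega> \<in> space M. uncovered i \<omega> (X i \<omega>)} =
      emeasure (distr M (PiM {..<n} (\<lambda>_. borel)) (\<lambda>\<omega>. \<lambda>i\<in>{..<n}. X i \<omega>)) ?A"
  proof (subst emeasure_distr[OF _ A])
    show "(\<lambda>\<omega>. \<lambda>i\<in>{..<n}. X i \<omega>) \<in> M \<rightarrow>\<^sub>M PiM {..<n} (\<lambda>_. borel)"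
      by (intro measurable_restrict measurable_X) simp
    have "(\<lambda>i\<in>{..<n}. X i \<omega>) \<in> ?A \<longleftrightarrow> uncovered i \<omega> (X i \<omega>)" for \<omega>
    proof -
      have "(\<lambda>i\<in>{..<n}. X i \<omega>) \<in> space (PiM {..<n} (\<lambda>_. borel))"
        by (simp add: space_PiM)
      moreover have "(\<lambda>i\<in>{..<n}. X i \<omega>) i = X i \<omega>"
        using assms by simp
      moreover have "(\<forall>j\<in>?J. 1 / h \<le> dist (X i \<omega>) ((\<lambda>i\<in>{..<n}. X i \<omega>) j)) \<longleftrightarrow>
          (\<forall>j\<in>?J. 1 / h \<le> dist (X i \<omega>) (X j \<omega>))"
        by (rule ball_cong[OF refl]) simp
      ultimately show ?thesis
        unfolding uncovered_def by (simp only: mem_Collect_eq simp_thms)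
    qed
    then have "{\<omega> \<in> space M. uncovered i \<omega> (X i \<omega>)} = (\<lambda>\<omega>. \<lambda>i\<in>{..<n}. X i \<omega>) -` ?A \<inter> space M"
      by blast
    then show "emeasure M {\<omega> \<in> space M. uncovered i \<omega> (X i \<omega>)} =
        emeasure M ((\<lambda>\<omega>. \<lambda>i\<in>{..<n}. X i \<omega>) -` ?A \<inter> space M)"
      by (rule arg_cong)
  qed
  also have "\<dots> = emeasure (PiM {..<n} (\<lambda>_. torus_uniform)) ?A"
    using n_pos by (subst distr_samples) (auto simp: lessThan_empty_iff)
  also have "\<dots> = (\<integral>\<^sup>+ y. indicator ?A y \<partial>PiM (insert i ?J) (\<lambda>_. torus_uniform))"
    unfolding I by (rule nn_integral_indicator[symmetric]) (simp only: sets_eq A)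
  also have "\<dots> = (\<integral>\<^sup>+ x. (\<integral>\<^sup>+ y. indicator ?A (y(i := x)) \<partial>PiM ?J (\<lambda>_. torus_uniform)) \<partial>torus_uniform)"
  proof (rule P.product_nn_integral_insert_rev)
    show "indicator ?A \<in> borel_measurable (PiM (insert i ?J) (\<lambda>_. torus_uniform))"
      unfolding I by (rule borel_measurable_indicator) (simp only: sets_eq A)
  qed simp_all
  also have "\<dots> \<le> (\<integral>\<^sup>+ x. ennreal \<kappa> \<partial>torus_uniform)"
  proof (rule nn_integral_mono)
    fix x
    have "(\<integral>\<^sup>+ y. indicator ?A (y(i := x)) \<partial>PiM ?J (\<lambda>_. torus_uniform)) =
        (\<integral>\<^sup>+ y. indicator (PiE ?J (\<lambda>_. {y. 1 / h \<le> dist x y})) y \<partial>PiM ?J (\<lambda>_. torus_uniform))"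
    proof (rule nn_integral_cong)
      fix y assume "y \<in> space (PiM ?J (\<lambda>_. torus_uniform))"
      then have y: "y \<in> extensional ?J"
        by (simp add: space_PiM PiE_iff)
      then have "y(i := x) \<in> space (PiM {..<n} (\<lambda>_. borel))"
        using assms by (simp add: space_PiM PiE_iff extensional_def)
      moreover have "(y(i := x)) i = x" "(y(i := x)) j = y j" if "j \<in> ?J" for j
        using that by simp_all
      ultimately have "y(i := x) \<in> ?A \<longleftrightarrow> y \<in> PiE ?J (\<lambda>_. {y. 1 / h \<le> dist x y})"
        unfolding PiE_iff using y by (simp only: mem_Collect_eq simp_thms cong: ball_cong)
      then show "indicator ?A (y(i := x)) = indicator (PiE ?J (\<lambda>_. {y. 1 / h \<le> dist x y})) y"
        by (simp only: indicator_def)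
    qed
    also have "\<dots> = emeasure (PiM ?J (\<lambda>_. torus_uniform)) (PiE ?J (\<lambda>_. {y. 1 / h \<le> dist x y}))"
      by (intro nn_integral_indicator sets_PiM_I_finite) auto
    also have "\<dots> \<le> ennreal \<kappa>"
      by (rule emeasure_PiM_uncovered[OF assms])
    finally show "(\<integral>\<^sup>+ y. indicator ?A (y(i := x)) \<partial>PiM ?J (\<lambda>_. torus_uniform)) \<le> ennreal \<kappa>" .
  qed
  also have "\<dots> = ennreal \<kappa>"
    using T.emeasure_space_1 by simp
  finally show ?thesis
    by (simp add: emeasure_eq_measure \<kappa>_def)
qed

lemma integrable_uncovered_pair:
  "integrable (M \<Otimes>\<^sub>M torus_uniform) (\<lambda>(\<omega>, x). of_bool (uncovered 0 \<omega> x) :: real)"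
proof (rule MT.P.integrable_const_bound[of _ 1])
  show "(\<lambda>(\<omega>, x). of_bool (uncovered 0 \<omega> x) :: real) \<in> borel_measurable (M \<Otimes>\<^sub>M torus_uniform)"
    unfolding split_beta' by (intro measurable_compose[OF measurable_uncovered measurable_of_bool]) measurable
qed (rule AE_I2, simp add: split_beta)

lemma integrable_uncovered_sample:
  assumes "i < n"
  shows "integrable M (\<lambda>\<omega>. of_bool (uncovered i \<omega> (X i \<omega>)) :: real)"
proof (rule integrable_const_bound[of _ 1])
  show "(\<lambda>\<omega>. of_bool (uncovered i \<omega> (X i \<omega>)) :: real) \<in> borel_measurable M"
    using assms by (intro measurable_compose[OF measurable_uncovered measurable_of_bool]) auto
qed (rule AE_I2, simp)

lemma expectation_of_bool:
  "expectation (\<lambda>\<omega>. of_bool (P \<omega>)) = prob {\<omega> \<in> space M. P \<omega>}"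
proof -
  have "expectation (\<lambda>\<omega>. of_bool (P \<omega>)) = expectation (indicator {\<omega> \<in> space M. P \<omega>})"
    by (intro Bochner_Integration.integral_cong) (auto simp: indicator_def)
  also have "\<dots> = prob ({\<omega> \<in> space M. P \<omega>} \<inter> space M)"
    by (rule Bochner_Integration.integral_indicator)
  also have "{\<omega> \<in> space M. P \<omega>} \<inter> space M = {\<omega> \<in> space M. P \<omega>}"
    by blast
  finally show ?thesis .
qed

text \<open>By linearity for the samples, and by Fubini's theorem for the integral over the torus,
  each of the two shares has expectation at most \<kappa>.\<close>

lemma
  shows integrable_uncovered_fraction: "integrable M uncovered_fraction"
    and expectation_uncovered_fraction: "expectation uncovered_fraction \<le> 2 * \<kappa>"
proof -
  have int_sum: "integrable M (\<lambda>\<omega>. (\<Sum>i<n. of_bool (uncovered i \<omega> (X i \<omega>))) / real n)"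
    by (intro integrable_divide_zero Bochner_Integration.integrable_sum integrable_uncovered_sample) auto
  have int_risk: "integrable M (\<lambda>\<omega>. LINT x|torus_uniform. of_bool (uncovered 0 \<omega> x) :: real)"
    using MT.integrable_fst'[OF integrable_uncovered_pair] by simp
  show "integrable M uncovered_fraction"
    unfolding uncovered_fraction_def[abs_def]
    using int_sum int_risk by (rule Bochner_Integration.integrable_add)
  have "expectation (\<lambda>\<omega>. (\<Sum>i<n. of_bool (uncovered i \<omega> (X i \<omega>))) / real n) =
      (\<Sum>i<n. prob {\<omega> \<in> space M. uncovered i \<omega> (X i \<omega>)}) / real n"
  proof -
    have "expectation (\<lambda>\<omega>. \<Sum>i<n. of_bool (uncovered i \<omega> (X i \<omega>)) :: real) =
        (\<Sum>i<n. expectation (\<lambda>\<omega>. of_bool (uncovered i \<omega> (X i \<omega>))))"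
      by (rule Bochner_Integration.integral_sum) (simp add: integrable_uncovered_sample)
    then show ?thesis
      by (simp only: integral_divide_zero expectation_of_bool)
  qed
  also have "\<dots> \<le> (\<Sum>i<n. \<kappa>) / real n"
    by (intro divide_right_mono sum_mono prob_uncovered_sample) simp_all
  also have "\<dots> = \<kappa>" using n by simp
  finally have 1: "expectation (\<lambda>\<omega>. (\<Sum>i<n. of_bool (uncovered i \<omega> (X i \<omega>))) / real n) \<le> \<kappa>" .
  have "expectation (\<lambda>\<omega>. LINT x|torus_uniform. of_bool (uncovered 0 \<omega> x) :: real) =
      (LINT x|torus_uniform. expectation (\<lambda>\<omega>. of_bool (uncovered 0 \<omega> x)))"
    using MT.Fubini_integral[OF integrable_uncovered_pair] by simp
  also have "\<dots> = (LINT x|torus_uniform. prob {\<omega> \<in> space M. uncovered 0 \<omega> x})"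
    by (simp only: expectation_of_bool)
  also have "\<dots> \<le> \<kappa>"
  proof -
    have "integrable torus_uniform (\<lambda>x. prob {\<omega> \<in> space M. uncovered 0 \<omega> x})"
      using MT.integrable_snd[OF integrable_uncovered_pair] by (simp only: expectation_of_bool)
    then show ?thesis
      by (intro T.integral_le_const AE_I2 prob_uncovered_point n_pos)
  qed
  finally show "expectation uncovered_fraction \<le> 2 * \<kappa>"
    unfolding uncovered_fraction_def[abs_def]
    using 1 by (subst Bochner_Integration.integral_add[OF int_sum int_risk]) linarith
qed

text \<open>Markov's inequality for \<open>uncovered_fraction\<close>: where the deviation exceeds
  \<open>t\<close>, \<open>t - L^2 / h^2\<close> is at most \<open>(sup_norm f)^2\<close> times that
  fraction. The multiplied form holds for every sign of \<open>t - L^2 / h^2\<close>.\<close>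

lemma prob_deviation_gt:
  "(t - L\<^sup>2 / h\<^sup>2) * prob {\<omega> \<in> space M. t < deviation \<omega>} \<le> 2 * \<kappa> * (sup_norm f)\<^sup>2"
proof -
  let ?E = "{\<omega> \<in> space M. t < deviation \<omega>}"
  have E: "?E \<in> sets M" by measurable
  have "(t - L\<^sup>2 / h\<^sup>2) * prob ?E = expectation (\<lambda>\<omega>. (t - L\<^sup>2 / h\<^sup>2) * indicator ?E \<omega>)"
    using E by simp
  also have "\<dots> \<le> expectation (\<lambda>\<omega>. (sup_norm f)\<^sup>2 * uncovered_fraction \<omega>)"
  proof (rule integral_mono)
    show "integrable M (\<lambda>\<omega>. (t - L\<^sup>2 / h\<^sup>2) * indicator ?E \<omega>)"
      using E by (intro integrable_mult_right integrable_real_indicator) (simp_all add: emeasure_eq_measure)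
    show "integrable M (\<lambda>\<omega>. (sup_norm f)\<^sup>2 * uncovered_fraction \<omega>)"
      by (intro integrable_mult_right integrable_uncovered_fraction)
    fix \<omega> assume "\<omega> \<in> space M"
    then show "(t - L\<^sup>2 / h\<^sup>2) * indicator ?E \<omega> \<le> (sup_norm f)\<^sup>2 * uncovered_fraction \<omega>"
      using deviation_le_uncovered_fraction[of \<omega>] uncovered_fraction_nonneg[of \<omega>]
      by (auto simp: indicator_def)
  qed
  also have "\<dots> = (sup_norm f)\<^sup>2 * expectation uncovered_fraction"
    by simp
  also have "\<dots> \<le> (sup_norm f)\<^sup>2 * (2 * \<kappa>)"
    by (intro mult_left_mono expectation_uncovered_fraction) auto
  finally show ?thesis by (simp add: mult_ac)
qed

end

section \<open>Tail bounds for the deviation\<close>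

text \<open>Inserting the bound on \<kappa> into the Markov estimate gives
  \<open>(t - s) * P \<le> 7 * \<gamma> * (\<gamma> * B)\<close>, and the bound on
  \<open>\<gamma> * B\<close> turns this into \<open>P \<le> 49 / 26 * \<gamma>\<close>.\<close>

lemma tail_bound_arith:
  fixes P t s B \<gamma> \<kappa> :: real
  assumes "s < t" and "26 / 7 * (\<gamma> * B) \<le> t - s" and "0 \<le> \<gamma>" and "0 \<le> B"
    and "(t - s) * P \<le> 2 * \<kappa> * B" and "\<kappa> \<le> 7 / 2 * \<gamma>\<^sup>2"
  shows "P \<le> 2 * \<gamma>"
proof -
  have "(t - s) * P \<le> 2 * \<kappa> * B" by fact
  also have "\<dots> \<le> 2 * (7 / 2 * \<gamma>\<^sup>2) * B"
    using assms by (intro mult_right_mono mult_left_mono) auto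
  also have "\<dots> = 7 * \<gamma> * (\<gamma> * B)" by (simp add: power2_eq_square)
  also have "\<dots> \<le> 7 * \<gamma> * (7 / 26 * (t - s))"
    using assms by (intro mult_left_mono) auto
  also have "\<dots> = (t - s) * (49 / 26 * \<gamma>)" by simp
  finally have "P \<le> 49 / 26 * \<gamma>"
    using assms(1) by (simp add: mult_le_cancel_left)
  then show ?thesis using assms(3) by linarith
qed

theorem theorem4p4:
  fixes M :: "'a measure" and X :: "nat \<Rightarrow> 'a \<Rightarrow> torus"
    and f :: "torus \<Rightarrow> real" and k :: "real \<Rightarrow> real"
    and n :: nat and h L \<gamma> :: real
    and Z :: "'a \<Rightarrow> (torus \<times> real) list" and D :: "'a \<Rightarrow> real"
  assumes "n \<ge> 3" and "h > 0"
    and "L > 0" and "L-lipschitz_on UNIV f"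
    and "kernel_profile h k"
    and "prob_space M"
    and "prob_space.indep_vars M (\<lambda>_. borel) X {..<n}"
    and "\<And>i. i < n \<Longrightarrow> distr M borel (X i) = torus_uniform"
    and "\<gamma> = (\<Sum>j = 1..nat \<lfloor>h\<rfloor>.
           (-1) ^ (j + 1) * real (n choose j) * (1 - real j / (2 * h)) ^ (n - 1))"
    and "\<And>\<omega>. Z \<omega> = sample_list f n (\<lambda>i. X i \<omega>)"
    and "\<And>\<omega>. D \<omega> = \<bar>cv_score k (Z \<omega>) - risk f (shepard k (leave_out 0 (Z \<omega>)))\<bar>"
  shows "(\<forall>\<epsilon>. \<epsilon> > 2 * \<gamma> * max ((4 * real n + 1) * L\<^sup>2 / h\<^sup>2) (4 * (sup_norm f)\<^sup>2) \<longrightarrow>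
            measure M {\<omega> \<in> space M. D \<omega> > \<epsilon>}
              \<le> 2 * \<gamma> + 2 * exp (- (h\<^sup>2 * \<epsilon> / (12 * sqrt (real n) * L\<^sup>2)
                                      - sqrt (2 * real n) * \<gamma>)\<^sup>2)) \<and>
         (\<forall>\<delta>. 0 < \<delta> \<and> \<delta> \<le> 1 \<longrightarrow>
            measure M {\<omega> \<in> space M.
              D \<omega> \<le> max (4 * \<gamma> * (sup_norm f)\<^sup>2)
                        (12 * sqrt (real n) * L\<^sup>2 / h\<^sup>2
                           * (sqrt (2 * real n) * \<gamma> + sqrt (- ln \<delta>)))}
              > 1 - 2 * (\<gamma> + \<delta>))"
proof -
  interpret prob_space M by fact
  interpret S: shepard_samples M X f k n h L
    using assms by unfold_locales auto
  define s where "s = L\<^sup>2 / h\<^sup>2"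
  define B where "B = (sup_norm f)\<^sup>2"
  have s: "0 < s" and B: "0 \<le> B"
    using \<open>L > 0\<close> \<open>h > 0\<close> by (simp_all add: s_def B_def)
  have D: "D \<omega> = S.deviation \<omega>" for \<omega>
    by (simp only: assms(10,11) S.deviation_def)
  have D_measurable: "D \<in> borel_measurable M"
    unfolding D[abs_def] by (rule S.measurable_deviation)
  define P where "P t = measure M {\<omega> \<in> space M. t < D \<omega>}" for t
  have markov: "(t - s) * P t \<le> 2 * S.\<kappa> * B" for t
    unfolding P_def D s_def B_def by (rule S.prob_deviation_gt)
  have P_zero: "P t = 0" if "s \<le> t" "B \<le> t" for t
  proof -
    have "{\<omega> \<in> space M. t < D \<omega>} = {}"
      using S.deviation_le_max that unfolding D s_def B_def by force
    then show ?thesis by (simp only: P_def measure_empty)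
  qed
  have \<gamma>: "0 \<le> \<gamma>" and dichotomy: "1 / 4 \<le> \<gamma> \<or> S.\<kappa> \<le> 7 / 2 * \<gamma>\<^sup>2"
    using alternating_gap_sum_lower_bound[OF \<open>n \<ge> 3\<close> \<open>h > 0\<close>] by (simp_all only: assms(9) S.\<kappa>_def)
  \<comment> \<open>If \<open>1 / 4 \<le> \<gamma>\<close>, then
    \<open>B \<le> 4 * (\<gamma> * B) \<le> t\<close>, and the event is empty; otherwise the bound
    on \<kappa> is available.\<close>
  have tail: "P t \<le> 2 * \<gamma>" if "s < t" "26 / 7 * (\<gamma> * B) \<le> t - s" "4 * (\<gamma> * B) \<le> t" for t
  proof (cases "1 / 4 \<le> \<gamma>")
    case True
    then have "1 / 4 * B \<le> \<gamma> * B" using B by (rule mult_right_mono)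
    then show ?thesis using P_zero[of t] that \<gamma> by simp
  next
    case False
    then show ?thesis
      using tail_bound_arith[OF that(1,2) \<gamma> B markov] dichotomy by simp
  qed
  show ?thesis
  proof (intro conjI allI impI)
    fix \<epsilon> :: real
    assume "\<epsilon> > 2 * \<gamma> * max ((4 * real n + 1) * L\<^sup>2 / h\<^sup>2) (4 * (sup_norm f)\<^sup>2)"
    moreover have "2 * \<gamma> * ((4 * real n + 1) * s) \<le> 2 * \<gamma> * max ((4 * real n + 1) * L\<^sup>2 / h\<^sup>2) (4 * (sup_norm f)\<^sup>2)"
      "2 * \<gamma> * (4 * B) \<le> 2 * \<gamma> * max ((4 * real n + 1) * L\<^sup>2 / h\<^sup>2) (4 * (sup_norm f)\<^sup>2)"
      using \<gamma> by (intro mult_left_mono; simp add: s_def B_def)+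
    ultimately have \<epsilon>: "2 * \<gamma> * ((4 * real n + 1) * s) < \<epsilon>" "8 * (\<gamma> * B) < \<epsilon>"
      by linarith+
    define u where "u = h\<^sup>2 * \<epsilon> / (12 * sqrt (real n) * L\<^sup>2)"
    define v where "v = sqrt (2 * real n) * \<gamma>"
    have "P \<epsilon> \<le> 2 * \<gamma> + 2 * exp (- (u - v)\<^sup>2)"
    proof (cases "\<epsilon> \<le> 6 * s")
      \<comment> \<open>The exponential term alone is at least \<open>1\<close>: the two squares
        satisfy \<open>u ^ 2 \<le> 1 / 12\<close> and \<open>v ^ 2 \<le> 3 / 8\<close>, and
        \<open>u * v\<close> is nonnegative, so the exponent is at least \<open>- 1 / 2\<close>. The
        bound on \<open>v\<close> comes from
        \<open>2 * \<gamma> * (4 * n + 1) * s < \<epsilon> \<le> 6 * s\<close>.\<close>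
      case True
      have "0 \<le> 2 * \<gamma> * ((4 * real n + 1) * s)" using \<gamma> s by simp
      then have "0 < \<epsilon>" using \<epsilon>(1) by linarith
      have "u = (\<epsilon> / s) / (12 * sqrt (real n))"
        using \<open>h > 0\<close> \<open>L > 0\<close> by (simp add: u_def s_def field_simps)
      then have u2: "u\<^sup>2 = (\<epsilon> / s)\<^sup>2 / (144 * real n)"
        by (simp add: power_divide power_mult_distrib)
      have "u \<ge> 0" using \<open>0 < \<epsilon>\<close> by (simp add: u_def)
      have "(\<epsilon> / s)\<^sup>2 \<le> 6\<^sup>2"
        using True s \<open>0 < \<epsilon>\<close> by (intro power_mono) (auto simp: field_simps)
      then have "u\<^sup>2 \<le> 36 / (144 * real n)"
        unfolding u2 by (intro divide_right_mono) auto
      also have "\<dots> \<le> 1 / 12" using \<open>n \<ge> 3\<close> by (simp add: field_simps)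
      finally have u: "u\<^sup>2 \<le> 1 / 12" .
      have "(2 * \<gamma> * (4 * real n + 1)) * s < 6 * s" using \<epsilon>(1) True by (simp add: mult_ac)
      then have "2 * \<gamma> * (4 * real n + 1) < 6" using s by simp
      then have "4 * (\<gamma> * real n) \<le> 3" using \<gamma> by (simp add: algebra_simps)
      then have "(4 * (\<gamma> * real n))\<^sup>2 \<le> 3\<^sup>2" using \<gamma> by (intro power_mono) auto
      then have "real n * (2 * real n * \<gamma>\<^sup>2) \<le> 9 / 8"
        by (simp add: power_mult_distrib power2_eq_square mult_ac)
      also have "\<dots> \<le> real n * (3 / 8)" using \<open>n \<ge> 3\<close> by simp
      finally have "2 * real n * \<gamma>\<^sup>2 \<le> 3 / 8"
        by (rule mult_left_le_imp_le) (use \<open>n \<ge> 3\<close> in simp)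
      then have v: "v\<^sup>2 \<le> 3 / 8"
        by (simp add: v_def power_mult_distrib)
      have "0 \<le> u * v" using \<open>u \<ge> 0\<close> \<gamma> by (simp add: v_def)
      then have "(u - v)\<^sup>2 \<le> 1 / 2"
        using u v by (simp add: power2_diff)
      then have "1 / 2 \<le> exp (- (u - v)\<^sup>2)"
        using exp_ge_add_one_self[of "- (u - v)\<^sup>2"] by linarith
      moreover have "P \<epsilon> \<le> 1" by (simp add: P_def)
      ultimately show ?thesis using \<gamma> by linarith
    next
      case False
      have "0 \<le> \<gamma> * B" using \<gamma> B by simp
      \<comment> \<open>Since \<open>\<epsilon> > 6 * s\<close>, the difference
        \<open>\<epsilon> - s\<close> exceeds \<open>5 / 6 * \<epsilon>\<close>, hence
        \<open>20 / 3 * (\<gamma> * B)\<close>.\<close>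
      then have "P \<epsilon> \<le> 2 * \<gamma>"
        using False \<epsilon>(2) s by (intro tail) linarith+
      then show ?thesis using exp_gt_zero[of "- (u - v)\<^sup>2"] by linarith
    qed
    then show "measure M {\<omega> \<in> space M. D \<omega> > \<epsilon>}
        \<le> 2 * \<gamma> + 2 * exp (- (h\<^sup>2 * \<epsilon> / (12 * sqrt (real n) * L\<^sup>2) - sqrt (2 * real n) * \<gamma>)\<^sup>2)"
      by (simp only: P_def u_def v_def)
  next
    fix \<delta> :: real
    assume \<delta>: "0 < \<delta> \<and> \<delta> \<le> 1"
    define t where "t = max (4 * \<gamma> * (sup_norm f)\<^sup>2)
      (12 * sqrt (real n) * L\<^sup>2 / h\<^sup>2 * (sqrt (2 * real n) * \<gamma> + sqrt (- ln \<delta>)))"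
    have "1 - 2 * (\<gamma> + \<delta>) < measure M {\<omega> \<in> space M. D \<omega> \<le> t}"
    proof (cases "\<delta> \<le> 1 / 2")
      case False
      then have "1 < 2 * \<delta>" by simp
      then have "1 - 2 * (\<gamma> + \<delta>) < 0" using \<gamma> unfolding distrib_left by linarith
      also have "0 \<le> measure M {\<omega> \<in> space M. D \<omega> \<le> t}" by simp
      finally show ?thesis .
    next
      case True
      have "1 / 2 \<le> - ln \<delta>" using ln_le_minus_one[of \<delta>] \<delta> True by linarith
      then have "sqrt (1 / 2) \<le> sqrt (- ln \<delta>)" by (rule real_sqrt_le_mono)
      then have "sqrt (real n) * sqrt (1 / 2) \<le> sqrt (real n) * sqrt (- ln \<delta>)"
        by (rule mult_left_mono) simp
      \<comment> \<open>The value \<open>7 / 6\<close> is a rational lower bound for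
        \<open>sqrt (3 / 2)\<close>; multiplied by \<open>12\<close> it gives the \<open>14\<close>
        below.\<close>
      moreover have "7 / 6 \<le> sqrt (real n) * sqrt (1 / 2)"
        unfolding real_sqrt_mult[symmetric] using \<open>n \<ge> 3\<close>
        by (intro real_le_rsqrt) (simp add: power2_eq_square)
      moreover have "0 \<le> sqrt (real n) * (sqrt (2 * real n) * \<gamma>)"
        using \<gamma> by simp
      ultimately have "7 / 6 \<le> sqrt (real n) * (sqrt (2 * real n) * \<gamma> + sqrt (- ln \<delta>))"
        unfolding distrib_left by linarith
      then have "(12 * s) * (7 / 6) \<le> (12 * s) * (sqrt (real n) * (sqrt (2 * real n) * \<gamma> + sqrt (- ln \<delta>)))"
        using s by (intro mult_left_mono) auto
      then have "14 * s \<le> 12 * sqrt (real n) * L\<^sup>2 / h\<^sup>2 * (sqrt (2 * real n) * \<gamma> + sqrt (- ln \<delta>))"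
        by (simp add: s_def mult_ac)
      then have "14 * s \<le> t" "4 * (\<gamma> * B) \<le> t"
        by (simp_all only: t_def B_def le_max_iff_disj mult.assoc order_refl simp_thms)
      \<comment> \<open>From \<open>14 * s \<le> t\<close> follows
        \<open>t - s \<ge> 13 / 14 * t\<close>, and \<open>13 / 14 * 4\<close> is the constant
        \<open>26 / 7\<close> that \<open>tail\<close> asks for.\<close>
      then have "P t \<le> 2 * \<gamma>"
        using s by (intro tail) linarith+
      moreover have "measure M {\<omega> \<in> space M. D \<omega> \<le> t} = 1 - P t"
      proof -
        have "{\<omega> \<in> space M. t < D \<omega>} \<in> events" using D_measurable by measurable
        from prob_compl[OF this] show ?thesis
          unfolding P_def by (simp add: set_diff_eq not_less conj_comms cong: conj_cong)
      qed
      ultimately show ?thesis using \<delta>[THEN conjunct1] unfolding distrib_left by linarith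
    qed
    then show "1 - 2 * (\<gamma> + \<delta>) < measure M {\<omega> \<in> space M.
        D \<omega> \<le> max (4 * \<gamma> * (sup_norm f)\<^sup>2)
          (12 * sqrt (real n) * L\<^sup>2 / h\<^sup>2 * (sqrt (2 * real n) * \<gamma> + sqrt (- ln \<delta>)))}"
      by (simp only: t_def)
  qed
qed

end
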